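(* For every precondition $\varphi$, command $C$ and postcondition $\psi$ of Total Outcome Logic: if $\vDash \langle\varphi\rangle\, C\, \langle\psi\rangle$ (i.e. $\llbracket C\rrbracket^\dagger(m)\in\psi$ for all $m\in\varphi$), then $\vdash\langle\varphi\rangle\, C\, \langle\psi\rangle$ is derivable in the proof system described below, relative to an oracle $\Omega$ containing all semantically valid triples $\langle\varphi'\rangle a\langle\psi'\rangle$ about atomic actions $a$ and deciding the semantic side conditions (implications and entailments).
   Context: Weights. Fix a (possibly partial) semiring $\mathcal A=\langle U,+,\cdot,0,1\rangle$: $+$ is a (possibly partial) commutative associative operation with unit $0$, $\cdot$ is associative with unit $1$, $\cdot$ distributes over $+$, and $0$ annihilates. Assume $\mathcal A$ is naturally ordered ($u\le v$ iff $u+w=v$ for some $w$ defines a partial order), bounded with top element $\top$, Scott-continuous, and complete (countable sums are suprema of finite partial sums). Weighting functions. Fix a set $\Sigma$ of program states and a fresh element $\natural\notin\Sigma$ representing nontermination; $\Sigma_\natural=\Sigma\cup\{\natural\}$. $\mathcal W(\Sigma_\natural)$ is the set of functions $m:\Sigma_\natural\to U$ whose mass $|m|=\sum_{\sigma\in\mathrm{supp}(m)}m(\sigma)$ is defined, where $\mathrm{supp}(m)=\{\sigma\mid m(\sigma)\ne0\}$. Operations are pointwise: $(m_1+m_2)(\sigma)=m_1(\sigma)+m_2(\sigma)$, $(u\cdot m)(\sigma)=u\cdot m(\sigma)$, $(m\cdot u)(\sigma)=m(\sigma)\cdot u$. $\eta(x)(y)=1$ if $x=y$, else $0$. For $f:\Sigma\to\mathcal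 W(\Sigma_\natural)$, $f^\dagger(m)(y)=\sum_{\sigma\in\mathrm{supp}(m)\cap\Sigma}m(\sigma)\cdot f(\sigma)(y)+m(\natural)\cdot\eta(\natural)(y)$. Fusion order: $m_1\sqsubseteq m_2$ iff $m_1(\sigma)\le m_2(\sigma)$ for $\sigma\in\Sigma$ and $m_1(\natural)\ge m_2(\natural)$. Language. $C::=\mathsf{skip}\mid\mathsf{assume}\ e\mid a\mid C_1;C_2\mid C_1+C_2\mid\mathsf{iter}(C,e_1,e_2)$; atomic actions $a$ have given interpretation $\llbracket a\rrbracket:\Sigma\to\mathcal W(\Sigma_\natural)$; guards $e::=b\mid u\in U$; Boolean expressions $b$ built from primitive tests $t\subseteq\Sigma$ with $\mathsf{true},\mathsf{false},\lor,\land,\lnot$, with $\llbracket b\rrbracket(\sigma)\in\{0,1\}$, and $\llbracket u\rrbracket(\sigma)=u$. $\llbracket\mathsf{skip}\rrbracket(\sigma)=\eta(\sigma)$; $\llbracket C_1;C_2\rrbracket(\sigma)=\llbracket C_2\rrbracket^\dagger(\llbracket C_1\rrbracket(\sigma))$; $\llbracket C_1+C_2\rrbracket(\sigma)=\llbracket C_1\rrbracket(\sigma)+\llbracket C_2\rrbracket(\sigma)$; $\llbracket\mathsf{assume}\ e\rrbracket(\sigma)=\llbracket e\rrbracket(\sigma)\cdot\eta(\sigma)$; $\llbracket\mathsf{iter}(C,e_1,e_2)\rrbracket$ is the least fixed point (pointwise fusion order; existence established by the paper under its standing domain restrictions) of $\Phi(f)(\sigma)=\llbracket e_1\rrbracket(\sigma)\cdot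 f^\dagger(\llbracket C\rrbracket(\sigma))+\llbracket e_2\rrbracket(\sigma)\cdot\eta(\sigma)$. Assertions are subsets of $\mathcal W(\Sigma_\natural)$. $\top=\mathcal W(\Sigma_\natural)$, $\bot=\emptyset$; $\lnot,\lor,\land$ set operations. $P^{(u)}=\{m\mid|m|=u,\mathrm{supp}(m)\subseteq P\}$ for $P\subseteq\Sigma$; $\Uparrow^{(u)}=\{u\cdot\top\cdot\eta(\natural)\}$; $u\odot\varphi=\{u\cdot m\mid m\in\varphi\}$; $\varphi\odot u=\{m\cdot u\mid m\in\varphi\}$; $\mathbf 1_m=\{m\}$; $\exists x{:}T.\phi(x)=\bigcup_{t}\phi(t)$; $\bigoplus_{x\in T}\phi(x)=\{\sum_t m_t\mid m_t\in\phi(t)\}$, binary case $\oplus$. $\vDash\langle\varphi\rangle C\langle\psi\rangle$ iff $\llbracket C\rrbracket^\dagger(m)\in\psi$ for all $m\in\varphi$. Side conditions: $\varphi\vDash e=u$ iff every $m\in\varphi$ has $\natural\notin\mathrm{supp}(m)$ and $\llbracket e\rrbracket(\sigma)=u$ on $\mathrm{supp}(m)$; $\varphi\vDash\mathsf{true}$ iff all $m\in\varphi$ have $\natural\notin\mathrm{supp}(m)$; $\varphi\vDash\mathsf{div}$ iff all $m\in\varphi$ have $\mathrm{supp}(m)\subseteq\{\natural\}$; $(\psi_n)\rightsquigarrow\psi_\infty$ iff $m_n\in\psi_n$ for all $n$ implies $\sum_n m_n\in\psi_\infty$; $(\psi_n)\Uparrow\psi_\infty$ iff $m_n\in\psi_n$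 for all $n$ implies $(\inf_n|m_n|\cdot\top)\cdot\eta(\natural)\in\psi_\infty$. Proof system ($\vdash$, with axioms from $\Omega$): False $\langle\bot\rangle C\langle\varphi\rangle$; True $\langle\varphi\rangle C\langle\top\rangle$; Div $\langle\Uparrow^{(u)}\rangle C\langle\Uparrow^{(u)}\rangle$; Scale (from $\langle\varphi\rangle C\langle\psi\rangle$ infer $\langle u\odot\varphi\rangle C\langle u\odot\psi\rangle$); Disj/Conj (combine two triples with $\lor$/$\land$ on both sides); Choice (from $\langle\phi(t)\rangle C\langle\phi'(t)\rangle$ for all $t\in T$ infer $\langle\bigoplus_{x\in T}\phi(x)\rangle C\langle\bigoplus_{x\in T}\phi'(x)\rangle$); Exists (same premises, conclude with $\exists x{:}T$ on both sides); Consequence (strengthen precondition/weaken postcondition by inclusion); Skip $\langle\varphi\rangle\mathsf{skip}\langle\varphi\rangle$; Seq (from $\langle\varphi\rangle C_1\langle\zeta\rangle$, $\langle\zeta\rangle C_2\langle\psi\rangle$ infer $\langle\varphi\rangle C_1;C_2\langle\psi\rangle$); Plus (from $\varphi\vDash\mathsf{true}$, $\langle\varphi\rangle C_i\langle\psi_i\rangle$ infer $\langle\varphi\rangle C_1+C_2\langle\psi_1\oplus\psi_2\rangle$); Assume (from $\varphi\vDash e=u$ infer $\langle\varphi\rangle\mathsf{assume}\ e\langle\varphi\odot u\rangle$); Iter (from $(\psi_n)\rightsquigarrow\psi_\infty$, $(\varphi_n\oplus\zeta_n)\Uparrow\zeta_\infty$, and for all $n$: $\varphi_n\vDash\mathsf{true}$,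 $\zeta_n\vDash\mathsf{div}$, $\langle\varphi_n\oplus\zeta_n\rangle\mathsf{assume}\ e;C\langle\varphi_{n+1}\oplus\zeta_{n+1}\rangle$, $\langle\varphi_n\rangle\mathsf{assume}\ e'\langle\psi_n\rangle$, infer $\langle\varphi_0\oplus\zeta_0\rangle\mathsf{iter}(C,e,e')\langle\psi_\infty\oplus\zeta_\infty\rangle$).
   Formalization: Added, as the claim fails otherwise: nontermination weights of atomic actions and of each m in φ have the form u·⊤; sums in the semantics are defined; each loop's least fixed point is the supremum of its Kleene iterates (no unbounded nondeterminism). *)

theory Defs
  imports Main "HOL-Library.Countable_Set"
begin

section \<open>Weights\<close>

context order
begin

definition is_lub :: "'a set \<Rightarrow> 'a \<Rightarrow> bool" where
  "is_lub S x \<longleftrightarrow> (\<forall>s\<in>S. s \<le> x) \<and> (\<forall>y. (\<forall>s\<in>S. s \<le> y) \<longrightarrow> x \<le> y)"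

definition is_glb :: "'a set \<Rightarrow> 'a \<Rightarrow> bool" where
  "is_glb S x \<longleftrightarrow> (\<forall>s\<in>S. x \<le> s) \<and> (\<forall>y. (\<forall>s\<in>S. y \<le> s) \<longrightarrow> y \<le> x)"

definition directed :: "'a set \<Rightarrow> bool" where
  "directed D \<longleftrightarrow> D \<noteq> {} \<and> (\<forall>x\<in>D. \<forall>y\<in>D. \<exists>z\<in>D. x \<le> z \<and> y \<le> z)"

end

text \<open>
  Partial addition returns an option; a total semiring has \<open>padd a b = Some (a + b)\<close>.
  Associativity is the strong (Kleene) one: one side is defined iff the other is. In the
  distributive laws only the definedness of the inner sum is given: in the semiring \<open>[0,1]\<close>,
  \<open>1/2 * 1 + 1/2 * 1\<close> is defined although \<open>1 + 1\<close> is not.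
\<close>

class partial_semiring = order + monoid_mult + mult_zero +
  fixes padd :: "'a \<Rightarrow> 'a \<Rightarrow> 'a option"
  assumes padd_commute: "padd a b = padd b a"
    and padd_assoc:
      "Option.bind (padd a b) (\<lambda>x. padd x c) = Option.bind (padd b c) (\<lambda>y. padd a y)"
    and padd_zero: "padd 0 a = Some a"
    and padd_distrib_left: "padd a b = Some c \<Longrightarrow> padd (u * a) (u * b) = Some (u * c)"
    and padd_distrib_right: "padd a b = Some c \<Longrightarrow> padd (a * u) (b * u) = Some (c * u)"
    and natural_order: "a \<le> b \<longleftrightarrow> (\<exists>c. padd a c = Some b)"
begin

definition oadd :: "'a option \<Rightarrow> 'a option \<Rightarrow> 'a option" where
  "oadd x y = Option.bind x (\<lambda>a. Option.bind y (\<lambda>b. padd a b))"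

sublocale osum: comm_monoid_set oadd "Some 0"
  defines osum = osum.F
proof
  fix a b c :: "'a option"
  show "oadd (oadd a b) c = oadd a (oadd b c)"
  proof (cases a; cases b; cases c)
    fix x y z
    assume "a = Some x" "b = Some y" "c = Some z"
    then show ?thesis
      using padd_assoc[of x y z] by (simp add: oadd_def)
  qed (auto simp: oadd_def bind_eq_None_conv split: bind_splits)
  show "oadd a b = oadd b a"
    by (cases a; cases b) (simp_all add: oadd_def padd_commute)
  show "oadd a (Some 0) = a"
    by (cases a) (simp_all add: oadd_def padd_commute[of _ 0] padd_zero)
qed

text \<open>The sum of a finite family, \<open>None\<close> if undefined.\<close>

definition fsum :: "('b \<Rightarrow> 'a) \<Rightarrow> 'b set \<Rightarrow> 'a option" where
  "fsum f F = osum (\<lambda>x. Some (f x)) F"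

text \<open>Total version of addition, unspecified where \<open>padd\<close> is undefined.\<close>

definition tadd :: "'a \<Rightarrow> 'a \<Rightarrow> 'a" where
  "tadd a b = the (padd a b)"

text \<open>
  Countable sums are suprema of the finite partial sums. Index sets may be uncountable as long as
  only countably many terms are nonzero.
\<close>

definition has_psum :: "('b \<Rightarrow> 'a) \<Rightarrow> 'b set \<Rightarrow> 'a \<Rightarrow> bool" where
  "has_psum f A s \<longleftrightarrow>
     countable {x\<in>A. f x \<noteq> 0} \<and>
     (\<forall>F. finite F \<and> F \<subseteq> A \<longrightarrow> fsum f F \<noteq> None) \<and>
     is_lub {t. \<exists>F. finite F \<and> F \<subseteq> A \<and> fsum f F = Some t} s"

definition psum :: "('b \<Rightarrow> 'a) \<Rightarrow> 'b set \<Rightarrow> 'a" where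
  "psum f A = (THE s. has_psum f A s)"

end

text \<open>
  Scott continuity includes definedness: the sum with a directed supremum is defined if the sums
  with all elements of the directed set are.
\<close>

class outcome_semiring = partial_semiring + order_top +
  assumes scott_padd:
      "directed D \<Longrightarrow> is_lub D s \<Longrightarrow> (\<And>d. d \<in> D \<Longrightarrow> padd d a = Some (g d)) \<Longrightarrow>
       \<exists>t. padd s a = Some t \<and> is_lub (g ` D) t"
    and scott_mult_left: "directed D \<Longrightarrow> is_lub D s \<Longrightarrow> is_lub ((\<lambda>d. u * d) ` D) (u * s)"
    and scott_mult_right: "directed D \<Longrightarrow> is_lub D s \<Longrightarrow> is_lub ((\<lambda>d. d * u) ` D) (s * u)"
    and complete:
      "(\<And>N :: nat set. finite N \<Longrightarrow> fsum f N \<noteq> None) \<Longrightarrow> \<exists>s. has_psum f UNIV s"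


section \<open>Weighting functions\<close>

text \<open>\<open>'s\<close> is the type of program states; \<open>None\<close> represents nontermination.\<close>

abbreviation nonterm :: "'s option"  (\<open>\<natural>\<close>) where
  "\<natural> \<equiv> None"

type_synonym ('s, 'u) wfun = "'s option \<Rightarrow> 'u"

definition supp :: "('s, 'u::outcome_semiring) wfun \<Rightarrow> 's option set" where
  "supp m = {x. m x \<noteq> 0}"

definition mass :: "('s, 'u::outcome_semiring) wfun \<Rightarrow> 'u" where
  "mass m = psum m (supp m)"

definition \<W> :: "('s, 'u::outcome_semiring) wfun set" where
  "\<W> = {m. \<exists>s. has_psum m (supp m) s}"

definition unit :: "'s option \<Rightarrow> ('s, 'u::outcome_semiring) wfun"  (\<open>\<eta>\<close>) where
  "\<eta> x y = (if x = y then 1 else 0)"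

definition lscale :: "'u \<Rightarrow> ('s, 'u::outcome_semiring) wfun \<Rightarrow> ('s, 'u) wfun" where
  "lscale u m = (\<lambda>x. u * m x)"

definition rscale :: "('s, 'u::outcome_semiring) wfun \<Rightarrow> 'u \<Rightarrow> ('s, 'u) wfun" where
  "rscale m u = (\<lambda>x. m x * u)"

definition wadd ::
  "('s, 'u::outcome_semiring) wfun \<Rightarrow> ('s, 'u) wfun \<Rightarrow> ('s, 'u) wfun" where
  "wadd m1 m2 = (\<lambda>x. tadd (m1 x) (m2 x))"

definition has_wadd ::
  "('s, 'u::outcome_semiring) wfun \<Rightarrow> ('s, 'u) wfun \<Rightarrow> ('s, 'u) wfun \<Rightarrow> bool" where
  "has_wadd m1 m2 m \<longleftrightarrow> m \<in> \<W> \<and> (\<forall>x. padd (m1 x) (m2 x) = Some (m x))"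

definition has_wsum ::
  "('i \<Rightarrow> ('s, 'u::outcome_semiring) wfun) \<Rightarrow> 'i set \<Rightarrow> ('s, 'u) wfun \<Rightarrow> bool" where
  "has_wsum M T m \<longleftrightarrow> m \<in> \<W> \<and> (\<forall>x. has_psum (\<lambda>t. M t x) T (m x))"

definition dagger ::
  "('s \<Rightarrow> ('s, 'u::outcome_semiring) wfun) \<Rightarrow> ('s, 'u) wfun \<Rightarrow> ('s, 'u) wfun" where
  "dagger f m = (\<lambda>y.
     tadd (psum (\<lambda>\<sigma>. m (Some \<sigma>) * f \<sigma> y) {\<sigma>. Some \<sigma> \<in> supp m}) (m \<natural> * \<eta> \<natural> y))"

definition fusion_le ::
  "('s, 'u::outcome_semiring) wfun \<Rightarrow> ('s, 'u) wfun \<Rightarrow> bool"  (infix \<open>\<sqsubseteq>\<close> 50) where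
  "m1 \<sqsubseteq> m2 \<longleftrightarrow> (\<forall>\<sigma>. m1 (Some \<sigma>) \<le> m2 (Some \<sigma>)) \<and> m2 \<natural> \<le> m1 \<natural>"


section \<open>Commands\<close>

datatype 's bexp =
    Prim "'s set"
  | BTrue
  | BFalse
  | BOr "'s bexp" "'s bexp"
  | BAnd "'s bexp" "'s bexp"
  | BNot "'s bexp"

datatype ('s, 'u) guard = Test "'s bexp" | Weight 'u

datatype ('a, 's, 'u) cmd =
    Skip
  | Assume "('s, 'u) guard"
  | Act 'a
  | Seq "('a, 's, 'u) cmd" "('a, 's, 'u) cmd"
  | Plus "('a, 's, 'u) cmd" "('a, 's, 'u) cmd"
  | Iter "('a, 's, 'u) cmd" "('s, 'u) guard" "('s, 'u) guard"

primrec holds :: "'s bexp \<Rightarrow> 's \<Rightarrow> bool" where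
  "holds (Prim t) \<sigma> \<longleftrightarrow> \<sigma> \<in> t"
| "holds BTrue \<sigma> \<longleftrightarrow> True"
| "holds BFalse \<sigma> \<longleftrightarrow> False"
| "holds (BOr b1 b2) \<sigma> \<longleftrightarrow> holds b1 \<sigma> \<or> holds b2 \<sigma>"
| "holds (BAnd b1 b2) \<sigma> \<longleftrightarrow> holds b1 \<sigma> \<and> holds b2 \<sigma>"
| "holds (BNot b) \<sigma> \<longleftrightarrow> \<not> holds b \<sigma>"

primrec gval :: "('s, 'u::outcome_semiring) guard \<Rightarrow> 's \<Rightarrow> 'u" where
  "gval (Test b) \<sigma> = (if holds b \<sigma> then 1 else 0)"
| "gval (Weight u) \<sigma> = u"

text \<open>The order, least fixed points and suprema in the space \<open>\<Sigma> \<rightarrow> \<W>\<close>.\<close>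

definition kernels :: "('s \<Rightarrow> ('s, 'u::outcome_semiring) wfun) set" where
  "kernels = {f. \<forall>\<sigma>. f \<sigma> \<in> \<W>}"

definition kernel_le ::
  "('s \<Rightarrow> ('s, 'u::outcome_semiring) wfun) \<Rightarrow> ('s \<Rightarrow> ('s, 'u) wfun) \<Rightarrow> bool" where
  "kernel_le f g \<longleftrightarrow> (\<forall>\<sigma>. f \<sigma> \<sqsubseteq> g \<sigma>)"

definition kernel_bot :: "'s \<Rightarrow> ('s, 'u::outcome_semiring) wfun" where
  "kernel_bot \<sigma> = lscale top (\<eta> \<natural>)"

definition is_least_fixpoint ::
  "(('s \<Rightarrow> ('s, 'u::outcome_semiring) wfun) \<Rightarrow> ('s \<Rightarrow> ('s, 'u) wfun)) \<Rightarrow>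
   ('s \<Rightarrow> ('s, 'u) wfun) \<Rightarrow> bool" where
  "is_least_fixpoint \<Phi> f \<longleftrightarrow>
     f \<in> kernels \<and> \<Phi> f = f \<and> (\<forall>g\<in>kernels. \<Phi> g = g \<longrightarrow> kernel_le f g)"

definition is_kernel_lub ::
  "('s \<Rightarrow> ('s, 'u::outcome_semiring) wfun) set \<Rightarrow> ('s \<Rightarrow> ('s, 'u) wfun) \<Rightarrow> bool" where
  "is_kernel_lub S f \<longleftrightarrow>
     f \<in> kernels \<and> (\<forall>g\<in>S. kernel_le g f) \<and>
     (\<forall>h\<in>kernels. (\<forall>g\<in>S. kernel_le g h) \<longrightarrow> kernel_le f h)"

definition loop_fun ::
  "('s, 'u::outcome_semiring) guard \<Rightarrow> ('s, 'u) guard \<Rightarrow> ('s \<Rightarrow> ('s, 'u) wfun) \<Rightarrow>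
   ('s \<Rightarrow> ('s, 'u) wfun) \<Rightarrow> ('s \<Rightarrow> ('s, 'u) wfun)" where
  "loop_fun e1 e2 c f = (\<lambda>\<sigma>.
     wadd (lscale (gval e1 \<sigma>) (dagger f (c \<sigma>))) (lscale (gval e2 \<sigma>) (\<eta> (Some \<sigma>))))"

primrec denote ::
  "('a \<Rightarrow> 's \<Rightarrow> ('s, 'u::outcome_semiring) wfun) \<Rightarrow> ('a, 's, 'u) cmd \<Rightarrow>
   's \<Rightarrow> ('s, 'u) wfun" where
  "denote I Skip = (\<lambda>\<sigma>. \<eta> (Some \<sigma>))"
| "denote I (Assume e) = (\<lambda>\<sigma>. lscale (gval e \<sigma>) (\<eta> (Some \<sigma>)))"
| "denote I (Act a) = I a"
| "denote I (Seq C1 C2) = (\<lambda>\<sigma>. dagger (denote I C2) (denote I C1 \<sigma>))"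
| "denote I (Plus C1 C2) = (\<lambda>\<sigma>. wadd (denote I C1 \<sigma>) (denote I C2 \<sigma>))"
| "denote I (Iter C e1 e2) = (THE f. is_least_fixpoint (loop_fun e1 e2 (denote I C)) f)"

text \<open>
  The semantics is partial: addition can be undefined, and a least fixed point need not exist.
  \<open>well_defined\<close> collects the domain restrictions under which \<open>denote\<close> is meaningful: the sums in
  the semantics of \<open>Plus\<close> and \<open>Iter\<close> are defined and have a mass, and every loop has a least fixed
  point, obtained as in Kleene's fixed point theorem as the supremum of the iterates from the
  bottom element. The latter amounts to continuity along this one chain. It excludes unbounded
  nondeterminism, for which the least fixed point is only reached transfinitely and disagrees with
  the limit \<open>inf\<^sub>n |m\<^sub>n| * top\<close> that the loop rule assigns to nontermination.
\<close>

primrec well_defined ::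
  "('a \<Rightarrow> 's \<Rightarrow> ('s, 'u::outcome_semiring) wfun) \<Rightarrow> ('a, 's, 'u) cmd \<Rightarrow> bool" where
  "well_defined I Skip \<longleftrightarrow> True"
| "well_defined I (Assume e) \<longleftrightarrow> True"
| "well_defined I (Act a) \<longleftrightarrow> True"
| "well_defined I (Seq C1 C2) \<longleftrightarrow> well_defined I C1 \<and> well_defined I C2"
| "well_defined I (Plus C1 C2) \<longleftrightarrow> well_defined I C1 \<and> well_defined I C2 \<and>
     (\<forall>\<sigma>. \<exists>m. has_wadd (denote I C1 \<sigma>) (denote I C2 \<sigma>) m)"
| "well_defined I (Iter C e1 e2) \<longleftrightarrow> well_defined I C \<and>
     (\<forall>f\<in>kernels. \<forall>\<sigma>. \<exists>m.
        has_wadd (lscale (gval e1 \<sigma>) (dagger f (denote I C \<sigma>)))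
                 (lscale (gval e2 \<sigma>) (\<eta> (Some \<sigma>))) m) \<and>
     (\<exists>f. is_least_fixpoint (loop_fun e1 e2 (denote I C)) f \<and>
          is_kernel_lub (range (\<lambda>n. (loop_fun e1 e2 (denote I C) ^^ n) kernel_bot)) f)"

text \<open>
  The weight of nontermination is of the form \<open>u * top\<close>, as in the assertion \<open>diverges u\<close> below.
  The denotational semantics assigns only such weights to nontermination if the atomic actions do.
  The restriction is vacuous if \<open>top = 1\<close> (Booleans, probabilities), but not for multiplicities in
  the extended natural numbers.
\<close>

definition saturated :: "('s, 'u::outcome_semiring) wfun \<Rightarrow> bool" where
  "saturated m \<longleftrightarrow> (\<exists>u. m \<natural> = u * top)"


section \<open>Assertions\<close>

text \<open>Assertions are subsets of \<open>\<W>\<close>; logical connectives on them are the set operations.\<close>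

type_synonym ('s, 'u) assn = "('s, 'u) wfun set"

definition diverges :: "'u \<Rightarrow> ('s, 'u::outcome_semiring) assn" where
  "diverges u = {lscale (u * top) (\<eta> \<natural>)}"

definition bigoplus ::
  "'i set \<Rightarrow> ('i \<Rightarrow> ('s, 'u::outcome_semiring) assn) \<Rightarrow> ('s, 'u) assn" where
  "bigoplus T \<phi> = {m. \<exists>M. (\<forall>t\<in>T. M t \<in> \<phi> t) \<and> has_wsum M T m}"

definition oplus ::
  "('s, 'u::outcome_semiring) assn \<Rightarrow> ('s, 'u) assn \<Rightarrow> ('s, 'u) assn"  (infixl \<open>\<oplus>\<close> 65) where
  "\<phi> \<oplus> \<psi> = {m. \<exists>m1\<in>\<phi>. \<exists>m2\<in>\<psi>. has_wadd m1 m2 m}"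

definition lscale_assn :: "'u \<Rightarrow> ('s, 'u::outcome_semiring) assn \<Rightarrow> ('s, 'u) assn" where
  "lscale_assn u \<phi> = lscale u ` \<phi>"

definition rscale_assn :: "('s, 'u::outcome_semiring) assn \<Rightarrow> 'u \<Rightarrow> ('s, 'u) assn" where
  "rscale_assn \<phi> u = (\<lambda>m. rscale m u) ` \<phi>"

definition valid ::
  "('a \<Rightarrow> 's \<Rightarrow> ('s, 'u::outcome_semiring) wfun) \<Rightarrow>
   ('s, 'u) assn \<Rightarrow> ('a, 's, 'u) cmd \<Rightarrow> ('s, 'u) assn \<Rightarrow> bool" where
  "valid I \<phi> C \<psi> \<longleftrightarrow> (\<forall>m\<in>\<phi>. dagger (denote I C) m \<in> \<psi>)"

definition entails_eq ::
  "('s, 'u::outcome_semiring) assn \<Rightarrow> ('s, 'u) guard \<Rightarrow> 'u \<Rightarrow> bool" where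
  "entails_eq \<phi> e u \<longleftrightarrow>
     (\<forall>m\<in>\<phi>. \<natural> \<notin> supp m \<and> (\<forall>\<sigma>. Some \<sigma> \<in> supp m \<longrightarrow> gval e \<sigma> = u))"

definition entails_true :: "('s, 'u::outcome_semiring) assn \<Rightarrow> bool" where
  "entails_true \<phi> \<longleftrightarrow> (\<forall>m\<in>\<phi>. \<natural> \<notin> supp m)"

definition entails_div :: "('s, 'u::outcome_semiring) assn \<Rightarrow> bool" where
  "entails_div \<phi> \<longleftrightarrow> (\<forall>m\<in>\<phi>. supp m \<subseteq> {\<natural>})"

text \<open>The existence of the infinite sum, respectively the infimum, is part of the conditions.\<close>

definition converges ::
  "(nat \<Rightarrow> ('s, 'u::outcome_semiring) assn) \<Rightarrow> ('s, 'u) assn \<Rightarrow> bool" where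
  "converges \<psi> \<psi>' \<longleftrightarrow>
     (\<forall>M. (\<forall>n. M n \<in> \<psi> n) \<longrightarrow> (\<exists>m\<in>\<psi>'. has_wsum M UNIV m))"

definition divergence_limit ::
  "(nat \<Rightarrow> ('s, 'u::outcome_semiring) assn) \<Rightarrow> ('s, 'u) assn \<Rightarrow> bool" where
  "divergence_limit \<theta> \<zeta>' \<longleftrightarrow>
     (\<forall>M. (\<forall>n. M n \<in> \<theta> n) \<longrightarrow>
        (\<exists>w. is_glb (range (\<lambda>n. mass (M n) * top)) w \<and> lscale w (\<eta> \<natural>) \<in> \<zeta>'))"


section \<open>Proof system\<close>

text \<open>
  An inductive definition cannot quantify over types, so the index sets of the rules \<open>Choice\<close> and
  \<open>Exists\<close> live in one fixed type. It is large enough to index every family of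
  (precondition, postcondition) pairs, each with countable multiplicity. Allowing further index
  types could only make more triples derivable.
\<close>

type_synonym ('s, 'u) index = "nat \<times> ('s, 'u) assn \<times> ('s, 'u) assn"

inductive derivable ::
  "(('s, 'u::outcome_semiring) assn \<times> 'a \<times> ('s, 'u) assn) set \<Rightarrow>
   ('s, 'u) assn \<Rightarrow> ('a, 's, 'u) cmd \<Rightarrow> ('s, 'u) assn \<Rightarrow> bool"
  for \<Omega> where
  Axiom: "(\<phi>, a, \<psi>) \<in> \<Omega> \<Longrightarrow> \<phi> \<subseteq> \<W> \<Longrightarrow> \<psi> \<subseteq> \<W> \<Longrightarrow> derivable \<Omega> \<phi> (Act a) \<psi>"
| False: "\<phi> \<subseteq> \<W> \<Longrightarrow> derivable \<Omega> {} C \<phi>"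
| True: "\<phi> \<subseteq> \<W> \<Longrightarrow> derivable \<Omega> \<phi> C \<W>"
| Div: "derivable \<Omega> (diverges u) C (diverges u)"
| Scale: "derivable \<Omega> \<phi> C \<psi> \<Longrightarrow> derivable \<Omega> (lscale_assn u \<phi>) C (lscale_assn u \<psi>)"
| Disj: "derivable \<Omega> \<phi>1 C \<psi>1 \<Longrightarrow> derivable \<Omega> \<phi>2 C \<psi>2 \<Longrightarrow>
    derivable \<Omega> (\<phi>1 \<union> \<phi>2) C (\<psi>1 \<union> \<psi>2)"
| Conj: "derivable \<Omega> \<phi>1 C \<psi>1 \<Longrightarrow> derivable \<Omega> \<phi>2 C \<psi>2 \<Longrightarrow>
    derivable \<Omega> (\<phi>1 \<inter> \<phi>2) C (\<psi>1 \<inter> \<psi>2)"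
| Choice: "(\<And>t :: ('s, 'u) index. t \<in> T \<Longrightarrow> derivable \<Omega> (\<phi> t) C (\<phi>' t)) \<Longrightarrow>
    derivable \<Omega> (bigoplus T \<phi>) C (bigoplus T \<phi>')"
| Exists: "(\<And>t :: ('s, 'u) index. t \<in> T \<Longrightarrow> derivable \<Omega> (\<phi> t) C (\<phi>' t)) \<Longrightarrow>
    derivable \<Omega> (\<Union>t\<in>T. \<phi> t) C (\<Union>t\<in>T. \<phi>' t)"
| Consequence: "\<phi>' \<subseteq> \<phi> \<Longrightarrow> derivable \<Omega> \<phi> C \<psi> \<Longrightarrow> \<psi> \<subseteq> \<psi>' \<Longrightarrow> \<psi>' \<subseteq> \<W> \<Longrightarrow>
    derivable \<Omega> \<phi>' C \<psi>'"
| Skip: "\<phi> \<subseteq> \<W> \<Longrightarrow> derivable \<Omega> \<phi> Skip \<phi>"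
| Seq: "derivable \<Omega> \<phi> C1 \<zeta> \<Longrightarrow> derivable \<Omega> \<zeta> C2 \<psi> \<Longrightarrow> derivable \<Omega> \<phi> (Seq C1 C2) \<psi>"
| Plus: "entails_true \<phi> \<Longrightarrow> derivable \<Omega> \<phi> C1 \<psi>1 \<Longrightarrow> derivable \<Omega> \<phi> C2 \<psi>2 \<Longrightarrow>
    derivable \<Omega> \<phi> (Plus C1 C2) (\<psi>1 \<oplus> \<psi>2)"
| Assume: "\<phi> \<subseteq> \<W> \<Longrightarrow> entails_eq \<phi> e u \<Longrightarrow>
    derivable \<Omega> \<phi> (Assume e) (rscale_assn \<phi> u)"
| Iter: "converges \<psi> \<psi>' \<Longrightarrow> divergence_limit (\<lambda>n. \<phi> n \<oplus> \<zeta> n) \<zeta>' \<Longrightarrow>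
    \<psi>' \<subseteq> \<W> \<Longrightarrow> \<zeta>' \<subseteq> \<W> \<Longrightarrow> (\<And>n. \<zeta> n \<subseteq> \<W>) \<Longrightarrow>
    (\<And>n. entails_true (\<phi> n)) \<Longrightarrow> (\<And>n. entails_div (\<zeta> n)) \<Longrightarrow>
    (\<And>n. derivable \<Omega> (\<phi> n \<oplus> \<zeta> n) (Seq (Assume e) C) (\<phi> (Suc n) \<oplus> \<zeta> (Suc n))) \<Longrightarrow>
    (\<And>n. derivable \<Omega> (\<phi> n) (Assume e') (\<psi> n)) \<Longrightarrow>
    derivable \<Omega> (\<phi> 0 \<oplus> \<zeta> 0) (Iter C e e') (\<psi>' \<oplus> \<zeta>')"

end

(*
  It suffices to derive, by induction on C, the triples {eta sigma} C {[[C]] sigma} for single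
  states: a saturated m is the weighted sum of the units eta x over its support, so Scale (Div at
  the nonterminating state) and Choice yield {m} C {[[C]]^dagger m}, and Exists collects these
  triples over all m in the precondition.

  For a loop, put K sigma = e1(sigma) * [[C]] sigma and m_n = K^n sigma, split into its proper and
  its nonterminating part. The n-th Kleene iterate F n satisfies F n sigma tau =
  (SUM k<n. K^k sigma tau * e2 tau) on proper states and F n sigma = |K^n sigma| * top at
  nontermination. Replacing the nonterminating part by any lower bound of the latter sequence still
  leaves an upper bound of the chain, so leastness identifies the fixed point with exactly the
  infinite sum and the infimum that the rule Iter computes.
*)
theory Submission
  imports Defs
begin

text \<open>Two obstacles shape the proof. Addition is partial, so each sum must be shown to be
  defined before it is evaluated; naturality of the order and completeness reduce this to domination
  by a sum that is known to exist. Moreover, for an arbitrary command the exact triple at pure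
  nontermination comes from \<open>Div\<close>, which covers only weights \<open>u * top\<close>;
  hence saturation is carried through the induction, even through the fixed point of a loop. For
  loops, leastness only speaks about competitors in \<open>kernels\<close>. The delicate point is
  therefore that a pointwise constructed competitor has a mass, although the state space may be
  uncountable.\<close>

section \<open>Finite and infinite sums\<close>

text \<open>\<open>None\<close> is the greatest element, so sums are monotone without side conditions on definedness.\<close>

definition ole :: "'u::partial_semiring option \<Rightarrow> 'u option \<Rightarrow> bool" where
  "ole x y \<longleftrightarrow> (\<exists>z. oadd x z = y)"

lemma oadd_simps [simp]:
  "oadd (Some a) (Some b) = padd a b" "oadd None y = None" "oadd x None = None"
  by (cases x; simp add: oadd_def)+

lemma padd_zero_right: "padd (a :: 'u::partial_semiring) 0 = Some a"
  using padd_commute[of a 0] padd_zero[of a] by simp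

lemma ole_Some [simp]: "ole (Some a) (Some b) \<longleftrightarrow> (a :: 'u::partial_semiring) \<le> b"
proof
  assume "ole (Some a) (Some b)"
  then obtain z where "oadd (Some a) z = Some b" by (auto simp: ole_def)
  then show "a \<le> b" by (cases z) (auto simp: natural_order)
next
  assume "a \<le> b"
  then obtain c where "padd a c = Some b" by (auto simp: natural_order)
  then show "ole (Some a) (Some b)" unfolding ole_def by (intro exI[of _ "Some c"]) simp
qed

lemma ole_None [simp]: "ole x None"
  unfolding ole_def by (intro exI[of _ None]) simp

lemma ole_SomeD: "ole x (Some b) \<Longrightarrow> \<exists>a. x = Some a \<and> a \<le> (b :: 'u::partial_semiring)"
  by (cases x) (auto, auto simp: ole_def)

lemma ole_defined: "ole x y \<Longrightarrow> y \<noteq> None \<Longrightarrow> x \<noteq> None"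
  by (cases x) (auto simp: ole_def)

lemma ole_refl [simp]: "ole x x"
  unfolding ole_def by (intro exI[of _ "Some 0"]) (simp add: osum.comm_neutral)

lemma ole_trans: "ole x y \<Longrightarrow> ole y z \<Longrightarrow> ole x z"
  unfolding ole_def by (metis osum.assoc)

lemma ole_add: "ole x x' \<Longrightarrow> ole y y' \<Longrightarrow> ole (oadd x y) (oadd x' y')"
  unfolding ole_def
proof (elim exE)
  fix z w assume "oadd x z = x'" "oadd y w = y'"
  then show "\<exists>z. oadd (oadd x y) z = oadd x' y'"
    by (intro exI[of _ "oadd z w"]) (auto simp: osum.assoc osum.left_commute)
qed

lemma zero_le [simp]: "(0 :: 'u::partial_semiring) \<le> a"
  using padd_zero natural_order by blast

lemma le_zero_iff [simp]: "(a :: 'u::partial_semiring) \<le> 0 \<longleftrightarrow> a = 0"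
  using zero_le by (auto intro: antisym)

lemma osum_mono: "(\<And>i. i \<in> F \<Longrightarrow> ole (f i) (g i)) \<Longrightarrow> ole (osum f F) (osum g F)"
  by (induction F rule: infinite_finite_induct) (auto intro: ole_add)

lemma osum_mono_set: "finite G \<Longrightarrow> F \<subseteq> G \<Longrightarrow> ole (osum f F) (osum f G)"
  using osum.subset_diff[of F G f] unfolding ole_def by (metis osum.commute)

lemma fsum_empty [simp]: "fsum f {} = Some 0"
  by (simp add: fsum_def)

lemma fsum_insert [simp]:
  "finite F \<Longrightarrow> x \<notin> F \<Longrightarrow> fsum f (insert x F) = oadd (Some (f x)) (fsum f F)"
  by (simp add: fsum_def)

lemma fsum_mono: "(\<And>i. i \<in> F \<Longrightarrow> f i \<le> g i) \<Longrightarrow> ole (fsum f F) (fsum g F)"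
  unfolding fsum_def by (rule osum_mono) simp

lemma fsum_mono_set: "finite G \<Longrightarrow> F \<subseteq> G \<Longrightarrow> ole (fsum f F) (fsum f G)"
  unfolding fsum_def by (rule osum_mono_set)

lemma fsum_cong: "(\<And>i. i \<in> F \<Longrightarrow> f i = g i) \<Longrightarrow> fsum f F = fsum g F"
  unfolding fsum_def by (rule osum.cong) auto

lemma fsum_union_disjoint:
  "finite F \<Longrightarrow> finite G \<Longrightarrow> F \<inter> G = {} \<Longrightarrow> fsum f (F \<union> G) = oadd (fsum f F) (fsum f G)"
  unfolding fsum_def by (rule osum.union_disjoint)

lemma fsum_reindex: "inj_on h F \<Longrightarrow> fsum f (h ` F) = fsum (\<lambda>x. f (h x)) F"
  unfolding fsum_def by (simp add: osum.reindex comp_def)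

lemma fsum_neutral_cong:
  "finite G \<Longrightarrow> F \<subseteq> G \<Longrightarrow> (\<And>x. x \<in> G - F \<Longrightarrow> f x = 0) \<Longrightarrow> fsum f F = fsum f G"
  unfolding fsum_def by (rule osum.mono_neutral_left) auto

text \<open>Distributivity transfers definedness only from the unscaled sum to the scaled one, hence
  a premise instead of an equation between options.\<close>

lemma fsum_mult_left:
  "fsum f F = Some t \<Longrightarrow> fsum (\<lambda>x. u * f x) F = Some (u * t)"
  for f :: "'i \<Rightarrow> 'u::partial_semiring"
proof (induction F arbitrary: t rule: infinite_finite_induct)
  case (insert x F)
  then obtain r where "fsum f F = Some r" "padd (f x) r = Some t"
    by (cases "fsum f F") auto
  with insert show ?case by (auto intro: padd_distrib_left)
qed (auto simp: fsum_def)

lemma fsum_mult_right: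
  "fsum f F = Some t \<Longrightarrow> fsum (\<lambda>x. f x * u) F = Some (t * u)"
  for f :: "'i \<Rightarrow> 'u::partial_semiring"
proof (induction F arbitrary: t rule: infinite_finite_induct)
  case (insert x F)
  then obtain r where "fsum f F = Some r" "padd (f x) r = Some t"
    by (cases "fsum f F") auto
  with insert show ?case by (auto intro: padd_distrib_right)
qed (auto simp: fsum_def)

section \<open>Countable sums as suprema of finite partial sums\<close>

definition psummable :: "('i \<Rightarrow> 'u::partial_semiring) \<Rightarrow> 'i set \<Rightarrow> bool" where
  "psummable f A \<longleftrightarrow>
     countable {x\<in>A. f x \<noteq> 0} \<and> (\<forall>F. finite F \<and> F \<subseteq> A \<longrightarrow> fsum f F \<noteq> None)"

definition psums :: "('i \<Rightarrow> 'u::partial_semiring) \<Rightarrow> 'i set \<Rightarrow> 'u set" where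
  "psums f A = {t. \<exists>F. finite F \<and> F \<subseteq> A \<and> fsum f F = Some t}"

text \<open>The doubly negated form exposes the quantifier pattern that the transport lemmas prove
  for an arbitrary predicate on \<open>fsum f F\<close>, so one fact settles both
  \<open>psums\<close> and \<open>psummable\<close>.\<close>

lemma psums_alt:
  "psums f A = {t. \<not> (\<forall>F. finite F \<and> F \<subseteq> A \<longrightarrow> fsum f F \<noteq> Some t)}"
  by (auto simp: psums_def)

lemma has_psum_alt: "has_psum f A s \<longleftrightarrow> psummable f A \<and> is_lub (psums f A) s"
  by (auto simp: has_psum_def psummable_def psums_def)

lemma is_lub_unique: "is_lub S a \<Longrightarrow> is_lub S b \<Longrightarrow> a = (b :: 'u::order)"
  by (auto simp: is_lub_def intro: antisym)

lemma has_psum_unique: "has_psum f A s \<Longrightarrow> has_psum f A t \<Longrightarrow> s = t"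
  by (auto simp: has_psum_alt intro: is_lub_unique)

lemma psum_eq: "has_psum f A s \<Longrightarrow> psum f A = s"
  unfolding psum_def by (blast intro: has_psum_unique)

lemma psums_directed:
  assumes "psummable f A" shows "directed (psums f A)"
  unfolding directed_def
proof (intro conjI ballI)
  have "0 \<in> psums f A" unfolding psums_def by (intro CollectI exI[of _ "{}"]) simp
  then show "psums f A \<noteq> {}" by blast
  fix s t assume "s \<in> psums f A" "t \<in> psums f A"
  then obtain F G where F: "finite F" "F \<subseteq> A" "fsum f F = Some s"
    and G: "finite G" "G \<subseteq> A" "fsum f G = Some t" by (auto simp: psums_def)
  then obtain r where r: "fsum f (F \<union> G) = Some r"
    using assms unfolding psummable_def by (metis finite_UnI not_Some_eq Un_least)
  then have "s \<le> r" "t \<le> r"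
    using fsum_mono_set[of "F \<union> G" F f] fsum_mono_set[of "F \<union> G" G f] F G by auto
  then show "\<exists>z\<in>psums f A. s \<le> z \<and> t \<le> z"
    using r F G by (intro bexI[of _ r]) (auto simp: psums_def intro!: exI[of _ "F \<union> G"])
qed

lemma psummable_subset: "psummable f A \<Longrightarrow> B \<subseteq> A \<Longrightarrow> psummable f B"
  unfolding psummable_def by (auto elim!: countable_subset[rotated])

lemma psummable_mono:
  assumes "psummable g A" "\<And>x. x \<in> A \<Longrightarrow> f x \<le> g x"
  shows "psummable f A"
  unfolding psummable_def
proof (intro conjI allI impI)
  have "{x \<in> A. f x \<noteq> 0} \<subseteq> {x \<in> A. g x \<noteq> 0}"
    using assms(2) le_zero_iff by force
  then show "countable {x \<in> A. f x \<noteq> 0}"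
    using assms(1) by (auto simp: psummable_def intro: countable_subset)
  fix F assume F: "finite F \<and> F \<subseteq> A"
  then have "fsum g F \<noteq> None" using assms(1) unfolding psummable_def by blast
  moreover have "ole (fsum f F) (fsum g F)" using F assms(2) by (intro fsum_mono) auto
  ultimately show "fsum f F \<noteq> None" by (rule ole_defined[rotated])
qed

lemma psummableD: "psummable f A \<Longrightarrow> finite F \<Longrightarrow> F \<subseteq> A \<Longrightarrow> fsum f F \<noteq> None"
  by (simp add: psummable_def)

lemma psumsI: "finite F \<Longrightarrow> F \<subseteq> A \<Longrightarrow> fsum f F = Some t \<Longrightarrow> t \<in> psums f A"
  unfolding psums_def by (intro CollectI exI[of _ F] conjI)

lemma psumsE:
  assumes "t \<in> psums f A"
  obtains F where "finite F" "F \<subseteq> A" "fsum f F = Some t"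
  using assms by (auto simp: psums_def)

text \<open>\<open>ole _ (Some s)\<close> asserts definedness and the bound at once, which spares
  later estimates case distinctions on options.\<close>

lemma has_psum_upper:
  assumes "has_psum f A s" "finite F" "F \<subseteq> A"
  shows "ole (fsum f F) (Some s)"
proof -
  have f: "psummable f A" and lub: "is_lub (psums f A) s"
    using assms by (simp_all add: has_psum_alt)
  obtain t where t: "fsum f F = Some t" using psummableD[OF f] assms by auto
  have "t \<in> psums f A" using assms(2,3) t by (rule psumsI)
  then have "t \<le> s" using lub by (simp add: is_lub_def)
  then show ?thesis using t by simp
qed

lemma has_psum_least:
  assumes "has_psum f A s" "\<And>F. finite F \<Longrightarrow> F \<subseteq> A \<Longrightarrow> ole (fsum f F) (Some y)"
  shows "s \<le> y"
proof -
  have "t \<le> y" if t: "t \<in> psums f A" for t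
    using t
  proof (rule psumsE)
    fix F assume "finite F" "F \<subseteq> A" "fsum f F = Some t"
    then show "t \<le> y" using assms(2)[of F] by simp
  qed
  then show ?thesis using assms(1) by (simp add: has_psum_alt is_lub_def)
qed

lemma has_psumI:
  assumes f: "psummable f A"
    and upper: "\<And>F. finite F \<Longrightarrow> F \<subseteq> A \<Longrightarrow> ole (fsum f F) (Some s)"
    and least: "\<And>y. (\<And>F. finite F \<Longrightarrow> F \<subseteq> A \<Longrightarrow> ole (fsum f F) (Some y)) \<Longrightarrow> s \<le> y"
  shows "has_psum f A s"
proof -
  have "s \<le> y" if y: "\<And>t. t \<in> psums f A \<Longrightarrow> t \<le> y" for y
  proof (rule least)
    fix F assume F: "finite F" "F \<subseteq> A"
    then obtain t where t: "fsum f F = Some t" using psummableD[OF f] by auto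
    then show "ole (fsum f F) (Some y)" using y[OF psumsI[OF F t]] by simp
  qed
  moreover have "t \<le> s" if t: "t \<in> psums f A" for t
    using t
  proof (rule psumsE)
    fix F assume "finite F" "F \<subseteq> A" "fsum f F = Some t"
    then show "t \<le> s" using upper[of F] by simp
  qed
  ultimately show ?thesis using f by (simp add: has_psum_alt is_lub_def)
qed

lemma has_psum_psummable: "has_psum f A s \<Longrightarrow> psummable f A"
  by (simp add: has_psum_alt)

lemma psummable_nat:
  assumes "\<And>n. fsum f {..<n} \<noteq> None" shows "psummable f (UNIV :: nat set)"
  unfolding psummable_def
proof (intro conjI allI impI)
  fix F :: "nat set" assume "finite F \<and> F \<subseteq> UNIV"
  then obtain n where "F \<subseteq> {..<n}" by (auto simp: finite_nat_iff_bounded)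
  then have "ole (fsum f F) (fsum f {..<n})" by (intro fsum_mono_set) auto
  then show "fsum f F \<noteq> None" using assms by (rule ole_defined)
qed auto

lemma has_psum_cong: "(\<And>x. x \<in> A \<Longrightarrow> f x = g x) \<Longrightarrow> has_psum f A s \<longleftrightarrow> has_psum g A s"
proof -
  assume eq: "\<And>x. x \<in> A \<Longrightarrow> f x = g x"
  have "fsum f F = fsum g F" if "F \<subseteq> A" for F using that eq by (intro fsum_cong) auto
  moreover have "{x\<in>A. f x \<noteq> 0} = {x\<in>A. g x \<noteq> 0}" using eq by auto
  ultimately show ?thesis
    unfolding has_psum_def by (simp cong: conj_cong)
qed

lemma has_psum_finite:
  assumes "finite A" "fsum f A = Some s"
  shows "has_psum f A s"
proof (rule has_psumI)
  have *: "ole (fsum f F) (Some s)" if "F \<subseteq> A" for F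
    using fsum_mono_set[of A F f] that assms by simp
  then show "ole (fsum f F) (Some s)" if "finite F" "F \<subseteq> A" for F using that by blast
  have "fsum f F \<noteq> None" if "F \<subseteq> A" for F using ole_defined[OF *[OF that]] by simp
  moreover have "countable {x \<in> A. f x \<noteq> 0}"
    using assms(1) by (intro countable_finite) simp
  ultimately show "psummable f A" unfolding psummable_def by blast
  show "s \<le> y" if "\<And>F. finite F \<Longrightarrow> F \<subseteq> A \<Longrightarrow> ole (fsum f F) (Some y)" for y
    using that[of A] assms by simp
qed

lemma has_psum_finiteD:
  assumes "finite A" "has_psum f A s"
  shows "fsum f A = Some s"
proof -
  obtain t where t: "fsum f A = Some t" using assms by (auto simp: has_psum_def)
  then show ?thesis using has_psum_finite[OF assms(1) t] assms(2) has_psum_unique by blast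
qed

lemma has_psum_reindex:
  assumes h: "inj_on h B"
  shows "has_psum f (h ` B) s \<longleftrightarrow> has_psum (\<lambda>x. f (h x)) B s"
proof -
  have 1: "{x \<in> h ` B. f x \<noteq> 0} = h ` {x \<in> B. f (h x) \<noteq> 0}" by auto
  have 2: "countable {x \<in> h ` B. f x \<noteq> 0} \<longleftrightarrow> countable {x \<in> B. f (h x) \<noteq> 0}"
    unfolding 1 using h by (intro countable_image_inj_eq) (auto simp: inj_on_def)
  have 3: "fsum f (h ` F) = fsum (\<lambda>x. f (h x)) F" if "F \<subseteq> B" for F
    using that h by (intro fsum_reindex) (rule inj_on_subset)
  have 4: "(\<forall>F. finite F \<and> F \<subseteq> h ` B \<longrightarrow> P (fsum f F)) \<longleftrightarrow>
      (\<forall>F. finite F \<and> F \<subseteq> B \<longrightarrow> P (fsum (\<lambda>x. f (h x)) F))" for P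
  proof safe
    fix F assume "\<forall>F. finite F \<and> F \<subseteq> h ` B \<longrightarrow> P (fsum f F)" "finite F" "F \<subseteq> B"
    then show "P (fsum (\<lambda>x. f (h x)) F)" using 3[of F] by (metis finite_imageI image_mono)
  next
    fix F assume *: "\<forall>F. finite F \<and> F \<subseteq> B \<longrightarrow> P (fsum (\<lambda>x. f (h x)) F)" "finite F" "F \<subseteq> h ` B"
    then obtain G where "G \<subseteq> B" "finite G" "F = h ` G" by (meson finite_subset_image)
    then show "P (fsum f F)" using * 3[of G] by metis
  qed
  have "psums f (h ` B) = psums (\<lambda>x. f (h x)) B"
    unfolding psums_alt by (intro Collect_cong arg_cong[of _ _ Not]) (rule 4)
  moreover have "psummable f (h ` B) = psummable (\<lambda>x. f (h x)) B"
    unfolding psummable_def using 2 4[of "\<lambda>x. x \<noteq> None"] by simp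
  ultimately show ?thesis by (simp add: has_psum_alt)
qed

lemma has_psum_neutral:
  assumes "A \<subseteq> B" "\<And>x. x \<in> B - A \<Longrightarrow> f x = 0"
  shows "has_psum f A s \<longleftrightarrow> has_psum f B s"
proof -
  have 1: "{x \<in> A. f x \<noteq> 0} = {x \<in> B. f x \<noteq> 0}" using assms by auto
  have 2: "fsum f F = fsum f (F \<inter> A)" if "finite F" "F \<subseteq> B" for F
    using that assms by (intro fsum_neutral_cong[symmetric]) auto
  have 3: "(\<forall>F. finite F \<and> F \<subseteq> A \<longrightarrow> P (fsum f F)) \<longleftrightarrow>
      (\<forall>F. finite F \<and> F \<subseteq> B \<longrightarrow> P (fsum f F))" for P
  proof safe
    fix F assume *: "\<forall>F. finite F \<and> F \<subseteq> A \<longrightarrow> P (fsum f F)" "finite F" "F \<subseteq> B"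
    then have "P (fsum f (F \<inter> A))" by (meson finite_Int inf_le2)
    then show "P (fsum f F)" using 2 * by simp
  qed (use assms in blast)
  have "psums f A = psums f B"
    unfolding psums_alt by (intro Collect_cong arg_cong[of _ _ Not]) (rule 3)
  moreover have "psummable f A = psummable f B"
    unfolding psummable_def 1 using 3[of "\<lambda>x. x \<noteq> None"] by simp
  ultimately show ?thesis by (simp add: has_psum_alt)
qed

lemma has_psum_single:
  assumes "a \<in> A" "\<And>x. x \<in> A \<Longrightarrow> x \<noteq> a \<Longrightarrow> f x = 0"
  shows "has_psum f A (f a)"
proof -
  have "has_psum f {a} (f a)" by (rule has_psum_finite) (auto simp: padd_zero_right)
  then show ?thesis using has_psum_neutral[of "{a}" A f] assms by auto
qed

lemma has_psum_zero:
  assumes "\<And>x. x \<in> A \<Longrightarrow> f x = 0" shows "has_psum f A 0"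
proof -
  have "has_psum f {} 0" by (rule has_psum_finite) auto
  then show ?thesis using has_psum_neutral[of "{}" A f] assms by auto
qed

text \<open>The axiom \<open>complete\<close> speaks about families over the natural numbers, so the
  countable support is enumerated. From here on, existence of a sum is a question of
  \<open>psummable\<close>, which passes to subsets and to smaller families.\<close>

lemma psummable_has_psum:
  fixes f :: "'i \<Rightarrow> 'u::outcome_semiring"
  assumes f: "psummable f A"
  shows "\<exists>s. has_psum f A s"
proof -
  define A' where "A' = {x \<in> A. f x \<noteq> 0}"
  have c: "countable A'" using f by (simp add: psummable_def A'_def)
  define h where "h = to_nat_on A'"
  define k where "k = from_nat_into A'"
  have h: "inj_on h A'" unfolding h_def using c by (rule inj_on_to_nat_on)
  have kh: "k (h x) = x" if "x \<in> A'" for x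
    using that c by (simp add: k_def h_def)
  \<comment> \<open>The image of \<open>h\<close> need not be all of the natural numbers; the
    remaining ones get weight 0.\<close>
  define g where "g n = (if n \<in> h ` A' then f (k n) else 0)" for n
  have g: "g (h x) = f x" if "x \<in> A'" for x using that kh by (simp add: g_def)
  have "fsum g N \<noteq> None" if N: "finite N" for N
  proof -
    have "N \<inter> h ` A' \<subseteq> h ` A'" "finite (N \<inter> h ` A')" using N by auto
    then obtain G where G: "G \<subseteq> A'" "finite G" "N \<inter> h ` A' = h ` G"
      by (meson finite_subset_image)
    have "fsum g N = fsum g (N \<inter> h ` A')"
      using N by (intro fsum_neutral_cong[symmetric]) (auto simp: g_def)
    also have "\<dots> = fsum (\<lambda>x. g (h x)) G"
      unfolding G using G h by (intro fsum_reindex) (auto intro: inj_on_subset)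
    also have "\<dots> = fsum f G" using g G by (intro fsum_cong) auto
    finally show ?thesis using f G by (auto simp: psummable_def A'_def)
  qed
  then obtain s where "has_psum g UNIV s" using complete by blast
  then have "has_psum g (h ` A') s"
    using has_psum_neutral[of "h ` A'" UNIV g] by (auto simp: g_def)
  then have "has_psum (\<lambda>x. g (h x)) A' s" by (simp add: has_psum_reindex[OF h])
  then have "has_psum f A' s" using has_psum_cong[of A' "\<lambda>x. g (h x)" f] g by blast
  moreover have "A' \<subseteq> A" "\<And>x. x \<in> A - A' \<Longrightarrow> f x = 0" by (auto simp: A'_def)
  ultimately have "has_psum f A s" by (metis has_psum_neutral)
  then show ?thesis by blast
qed

section \<open>Distributivity and rearrangement of countable sums\<close>

lemma psums_image:
  assumes f: "psummable f A"
    and fg: "\<And>F t. fsum f F = Some t \<Longrightarrow> fsum g F = Some (h t)"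
    and zero: "\<And>x. f x = 0 \<Longrightarrow> g x = 0"
  shows "psummable g A" "psums g A = h ` psums f A"
proof -
  have eq: "\<exists>t. fsum f F = Some t \<and> fsum g F = Some (h t)" if F: "finite F" "F \<subseteq> A" for F
  proof -
    obtain t where "fsum f F = Some t" using f F by (auto simp: psummable_def)
    then show ?thesis using fg by blast
  qed
  have "{x \<in> A. g x \<noteq> 0} \<subseteq> {x \<in> A. f x \<noteq> 0}" using zero by auto
  then have "countable {x \<in> A. g x \<noteq> 0}"
    by (rule countable_subset) (use f in \<open>simp add: psummable_def\<close>)
  then show "psummable g A" unfolding psummable_def using eq by (metis option.distinct(1))
  show "psums g A = h ` psums f A"
  proof (intro subset_antisym subsetI)
    fix t assume "t \<in> psums g A"
    then obtain F where F: "finite F" "F \<subseteq> A" "fsum g F = Some t" unfolding psums_def by blast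
    then obtain r where r: "fsum f F = Some r" "fsum g F = Some (h r)" using eq by blast
    then have "r \<in> psums f A" using F unfolding psums_def by blast
    then show "t \<in> h ` psums f A" using F r by auto
  next
    fix t assume "t \<in> h ` psums f A"
    then obtain F r where "finite F" "F \<subseteq> A" "fsum f F = Some r" "t = h r"
      unfolding psums_def by blast
    then show "t \<in> psums g A" using fg unfolding psums_def by blast
  qed
qed

lemma has_psum_mult_left:
  fixes f :: "'i \<Rightarrow> 'u::outcome_semiring"
  assumes f: "has_psum f A s"
  shows "has_psum (\<lambda>x. u * f x) A (u * s)"
proof -
  have sum: "psummable f A" and lub: "is_lub (psums f A) s"
    using f by (simp_all add: has_psum_alt)
  have "psummable (\<lambda>x. u * f x) A" "psums (\<lambda>x. u * f x) A = (\<lambda>t. u * t) ` psums f A"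
    by (rule psums_image[OF sum]; simp add: fsum_mult_left)+
  then show ?thesis
    using scott_mult_left[OF psums_directed[OF sum] lub, of u] by (simp add: has_psum_alt)
qed

lemma has_psum_mult_right:
  fixes f :: "'i \<Rightarrow> 'u::outcome_semiring"
  assumes f: "has_psum f A s"
  shows "has_psum (\<lambda>x. f x * u) A (s * u)"
proof -
  have sum: "psummable f A" and lub: "is_lub (psums f A) s"
    using f by (simp_all add: has_psum_alt)
  have "psummable (\<lambda>x. f x * u) A" "psums (\<lambda>x. f x * u) A = (\<lambda>t. t * u) ` psums f A"
    by (rule psums_image[OF sum]; simp add: fsum_mult_right)+
  then show ?thesis
    using scott_mult_right[OF psums_directed[OF sum] lub, of u] by (simp add: has_psum_alt)
qed

text \<open>Scott continuity of \<open>padd\<close> moves one argument at a time: first the partial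
  sum over \<open>A\<close> tends to \<open>s\<close> with the one over \<open>B\<close> fixed, then
  the latter tends to \<open>t\<close>. The sum \<open>r0\<close> over the union bounds everything
  in between.\<close>

lemma has_psum_union:
  fixes f :: "'i \<Rightarrow> 'u::outcome_semiring"
  assumes f: "psummable f (A \<union> B)" and disj: "A \<inter> B = {}"
    and s: "has_psum f A s" and t: "has_psum f B t"
  shows "\<exists>r. padd s t = Some r \<and> has_psum f (A \<union> B) r"
proof -
  have dA: "directed (psums f A)" and dB: "directed (psums f B)"
    using s t by (auto simp: has_psum_alt intro: psums_directed)
  have lA: "is_lub (psums f A) s" and lB: "is_lub (psums f B) t"
    using s t by (auto simp: has_psum_alt)
  obtain r0 where r0: "has_psum f (A \<union> B) r0" using psummable_has_psum[OF f] by blast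
  have ab: "\<exists>c. padd a b = Some c \<and> c \<le> r0"
    if a: "a \<in> psums f A" and b: "b \<in> psums f B" for a b
  proof -
    obtain F G where F: "finite F" "F \<subseteq> A" "fsum f F = Some a"
      and G: "finite G" "G \<subseteq> B" "fsum f G = Some b" using a b by (auto simp: psums_def)
    have "fsum f (F \<union> G) = oadd (fsum f F) (fsum f G)"
      using F G disj by (intro fsum_union_disjoint) auto
    moreover have "ole (fsum f (F \<union> G)) (Some r0)"
      using F G by (intro has_psum_upper[OF r0]) auto
    ultimately show ?thesis using F G ole_SomeD by fastforce
  qed
  have sb: "\<exists>c. padd s b = Some c \<and> c \<le> r0" if b: "b \<in> psums f B" for b
    using scott_padd[OF dA lA, of b "\<lambda>a. the (padd a b)"] ab[OF _ b]
    by (fastforce simp: is_lub_def)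
  have "\<exists>r. padd t s = Some r \<and> is_lub ((\<lambda>b. the (padd b s)) ` psums f B) r"
    using sb by (intro scott_padd[OF dB lB]) (fastforce simp: padd_commute[of _ s])
  then obtain r where r: "padd s t = Some r" and lub: "is_lub ((\<lambda>b. the (padd b s)) ` psums f B) r"
    by (auto simp: padd_commute[of t s])
  have "r \<le> r0"
    using lub sb by (fastforce simp: is_lub_def padd_commute[of _ s])
  moreover have "r0 \<le> r"
  proof (rule has_psum_least[OF r0])
    fix F assume F: "finite F" "F \<subseteq> A \<union> B"
    have "fsum f F = fsum f ((F \<inter> A) \<union> (F \<inter> B))" using F by (intro arg_cong[of _ _ "fsum f"]) auto
    also have "\<dots> = oadd (fsum f (F \<inter> A)) (fsum f (F \<inter> B))"
      using F disj by (intro fsum_union_disjoint) auto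
    also have "ole \<dots> (oadd (Some s) (Some t))"
      using F by (intro ole_add has_psum_upper[OF s] has_psum_upper[OF t]) auto
    finally show "ole (fsum f F) (Some r)" using r by simp
  qed
  ultimately show ?thesis using r r0 by (auto intro: antisym)
qed

text \<open>For finitely many rows this is a repeated disjoint union. In general the two suprema
  bound each other, since a finite set of pairs meets only finitely many rows.\<close>

lemma has_psum_Sigma_iterate:
  fixes f :: "'i \<Rightarrow> 'j \<Rightarrow> 'u::outcome_semiring"
  assumes f: "psummable (case_prod f) (Sigma A B)"
    and s: "\<And>i. i \<in> A \<Longrightarrow> has_psum (f i) (B i) (s i)"
  shows "\<exists>S. has_psum s A S \<and> has_psum (case_prod f) (Sigma A B) S"
proof -
  have fin: "\<exists>r. fsum s F = Some r \<and> has_psum (case_prod f) (Sigma F B) r"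
    if "finite F" "F \<subseteq> A" for F
    using that
  proof (induction F rule: finite_induct)
    case empty
    show ?case by (auto intro: has_psum_finite)
  next
    case (insert i F)
    then obtain r where r: "fsum s F = Some r" "has_psum (case_prod f) (Sigma F B) r" by auto
    have "has_psum (case_prod f) (Pair i ` B i) (s i)"
      using insert.prems s by (subst has_psum_reindex) (auto simp: inj_on_def)
    moreover have eq: "Sigma (insert i F) B = Pair i ` B i \<union> Sigma F B" by auto
    moreover have "psummable (case_prod f) (Sigma (insert i F) B)"
      using f by (rule psummable_subset) (use insert.prems in auto)
    moreover have "Pair i ` B i \<inter> Sigma F B = {}" using insert by auto
    ultimately obtain r' where "padd (s i) r = Some r'"
        "has_psum (case_prod f) (Sigma (insert i F) B) r'"
      using has_psum_union[of "case_prod f" "Pair i ` B i" "Sigma F B" "s i" r] r by auto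
    then show ?case using insert r by auto
  qed
  \<comment> \<open>A row with nonzero sum has a nonzero entry, so the countable support of the
    double family projects onto all such rows.\<close>
  have "{i \<in> A. s i \<noteq> 0} \<subseteq> fst ` {p \<in> Sigma A B. case_prod f p \<noteq> 0}"
  proof
    fix i assume i: "i \<in> {i \<in> A. s i \<noteq> 0}"
    have "\<exists>j\<in>B i. f i j \<noteq> 0"
    proof (rule ccontr)
      assume "\<not> ?thesis"
      then have "has_psum (f i) (B i) 0" by (intro has_psum_zero) blast
      then show "False" using i s has_psum_unique by blast
    qed
    then obtain j where "j \<in> B i" "f i j \<noteq> 0" by blast
    then have "(i, j) \<in> {p \<in> Sigma A B. case_prod f p \<noteq> 0}" using i by simp
    then show "i \<in> fst ` {p \<in> Sigma A B. case_prod f p \<noteq> 0}" by (rule rev_image_eqI) simp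
  qed
  moreover have "countable {p \<in> Sigma A B. case_prod f p \<noteq> 0}"
    using f unfolding psummable_def by blast
  ultimately have "countable {i \<in> A. s i \<noteq> 0}" by (meson countable_image countable_subset)
  moreover have "fsum s F \<noteq> None" if "finite F" "F \<subseteq> A" for F using fin[OF that] by auto
  ultimately have "psummable s A" unfolding psummable_def by blast
  then obtain S where S: "has_psum s A S" using psummable_has_psum by blast
  obtain S' where S': "has_psum (case_prod f) (Sigma A B) S'" using psummable_has_psum[OF f] by blast
  have "S \<le> S'"
  proof (rule has_psum_least[OF S])
    fix F assume F: "finite F" "F \<subseteq> A"
    then obtain r where r: "fsum s F = Some r" "has_psum (case_prod f) (Sigma F B) r"
      using fin by blast
    have "r \<le> S'"
    proof (rule has_psum_least[OF r(2)])
      fix G assume G: "finite G" "G \<subseteq> Sigma F B"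
      then show "ole (fsum (case_prod f) G) (Some S')"
        using F by (intro has_psum_upper[OF S']) auto
    qed
    then show "ole (fsum s F) (Some S')" using r by simp
  qed
  moreover have "S' \<le> S"
  proof (rule has_psum_least[OF S'])
    fix G assume G: "finite G" "G \<subseteq> Sigma A B"
    then have F: "finite (fst ` G)" "fst ` G \<subseteq> A" by auto
    then obtain r where r: "fsum s (fst ` G) = Some r"
        "has_psum (case_prod f) (Sigma (fst ` G) B) r"
      using fin by blast
    have "G \<subseteq> Sigma (fst ` G) B" using G by force
    then have "ole (fsum (case_prod f) G) (Some r)" using G by (intro has_psum_upper[OF r(2)])
    moreover have "ole (Some r) (Some S)" using has_psum_upper[OF S F] r by simp
    ultimately show "ole (fsum (case_prod f) G) (Some S)" by (rule ole_trans)
  qed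
  ultimately show ?thesis using S S' antisym by blast
qed

text \<open>A finite set of pairs is summed row by row, each row contributing at most its full sum,
  so definedness is inherited from the finite sums of \<open>s\<close>. For countability: a row with
  sum 0 has only zero entries, because 0 is least.\<close>

lemma psummable_Sigma:
  fixes f :: "'i \<Rightarrow> 'j \<Rightarrow> 'u::outcome_semiring"
  assumes s: "\<And>i. i \<in> A \<Longrightarrow> has_psum (f i) (B i) (s i)" and S: "psummable s A"
  shows "psummable (case_prod f) (Sigma A B)"
  unfolding psummable_def
proof (intro conjI allI impI)
  have nz: "s i \<noteq> 0" if "i \<in> A" "j \<in> B i" "f i j \<noteq> 0" for i j
  proof
    assume "s i = 0"
    then have "ole (fsum (f i) {j}) (Some 0)"
      using has_psum_upper[OF s[OF that(1)], of "{j}"] that by simp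
    then show "False" using that by (simp add: padd_zero_right)
  qed
  have "{p \<in> Sigma A B. case_prod f p \<noteq> 0} \<subseteq>
      Sigma {i \<in> A. s i \<noteq> 0} (\<lambda>i. {j \<in> B i. f i j \<noteq> 0})"
    using nz by auto
  moreover have "countable (Sigma {i \<in> A. s i \<noteq> 0} (\<lambda>i. {j \<in> B i. f i j \<noteq> 0}))"
    using S s by (intro countable_SIGMA) (auto simp: psummable_def has_psum_def)
  ultimately show "countable {p \<in> Sigma A B. case_prod f p \<noteq> 0}"
    by (rule countable_subset)
  fix G assume G: "finite G \<and> G \<subseteq> Sigma A B"
  define F where "F = fst ` G"
  define H where "H i = {j. (i, j) \<in> G}" for i
  have fin: "finite F" "finite (H i)" for i
  proof -
    have "H i \<subseteq> snd ` G" by (force simp: H_def)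
    then show "finite (H i)" using G finite_subset by blast
  qed (use G in \<open>simp add: F_def\<close>)
  have FA: "F \<subseteq> A" and HB: "H i \<subseteq> B i" for i using G by (auto simp: F_def H_def)
  have GS: "G = Sigma F H" by (force simp: F_def H_def)
  have "fsum (case_prod f) G = osum (\<lambda>i. fsum (f i) (H i)) F"
    unfolding GS fsum_def using fin
    by (subst osum.Sigma) (auto intro!: osum.cong)
  also have "ole \<dots> (osum (\<lambda>i. Some (s i)) F)"
    using FA HB fin by (intro osum_mono has_psum_upper[OF s]) auto
  finally have "ole (fsum (case_prod f) G) (fsum s F)" by (simp add: fsum_def)
  moreover have "fsum s F \<noteq> None" using S fin FA by (auto simp: psummable_def)
  ultimately show "fsum (case_prod f) G \<noteq> None" by (rule ole_defined)
qed

text \<open>A Fubini principle: the rows and their sums make the double family summable, after which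
  it can be regrouped by columns. All exchanges of summation in the semantics go through it.\<close>

lemma has_psum_swap:
  fixes f :: "'i \<Rightarrow> 'j \<Rightarrow> 'u::outcome_semiring"
  assumes r: "\<And>i. i \<in> A \<Longrightarrow> has_psum (f i) B (r i)" and R: "has_psum r A S"
    and c: "\<And>j. j \<in> B \<Longrightarrow> has_psum (\<lambda>i. f i j) A (c j)"
  shows "has_psum c B S"
proof -
  have sum: "psummable (case_prod f) (A \<times> B)"
    using r has_psum_psummable[OF R] by (rule psummable_Sigma)
  then obtain S' where "has_psum r A S'" "has_psum (case_prod f) (A \<times> B) S'"
    using has_psum_Sigma_iterate[OF sum r] by blast
  then have "has_psum (case_prod f) (A \<times> B) S" using R has_psum_unique by blast
  moreover have "A \<times> B = prod.swap ` (B \<times> A)" by auto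
  ultimately have "has_psum (\<lambda>p. case_prod f (prod.swap p)) (B \<times> A) S"
    using has_psum_reindex[of prod.swap "B \<times> A" "case_prod f" S] by simp
  moreover have "(\<lambda>p. case_prod f (prod.swap p)) = (\<lambda>(j, i). f i j)" by auto
  ultimately have S: "has_psum (\<lambda>(j, i). f i j) (B \<times> A) S" by simp
  then obtain S' where "has_psum c B S'" "has_psum (\<lambda>(j, i). f i j) (B \<times> A) S'"
    using has_psum_Sigma_iterate[OF has_psum_psummable[OF S] c] by blast
  then show ?thesis using S has_psum_unique by blast
qed


section \<open>Weighting functions and Kleisli extension\<close>

lemma mult_left_mono_natural: "a \<le> b \<Longrightarrow> u * a \<le> u * (b :: 'u::partial_semiring)"
  by (auto simp: natural_order dest: padd_distrib_left)

lemma mult_right_mono_natural: "a \<le> b \<Longrightarrow> a * u \<le> (b :: 'u::partial_semiring) * u"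
  by (auto simp: natural_order dest: padd_distrib_right)

lemma top_mult_top: "top * top = (top :: 'u::outcome_semiring)"
proof (rule antisym)
  have "(top :: 'u) = 1 * top" by simp
  also have "\<dots> \<le> top * top" by (rule mult_right_mono_natural) simp
  finally show "(top :: 'u) \<le> top * top" .
qed simp

lemma has_psum_supp: "has_psum m (supp m) = has_psum m UNIV"
  by (intro ext has_psum_neutral) (auto simp: supp_def)

lemma \<W>_iff: "m \<in> \<W> \<longleftrightarrow> psummable m UNIV"
  using psummable_has_psum[of m UNIV] has_psum_psummable[of m UNIV]
  by (auto simp: \<W>_def has_psum_supp)

lemma has_psum_mass: "m \<in> \<W> \<Longrightarrow> has_psum m UNIV (mass m)"
  using psum_eq[of m UNIV] by (auto simp: \<W>_def mass_def psum_def has_psum_supp)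

lemma \<W>_mono: "m \<in> \<W> \<Longrightarrow> (\<And>x. m' x \<le> m x) \<Longrightarrow> m' \<in> \<W>"
  unfolding \<W>_iff by (rule psummable_mono)

lemma has_psum_\<W>: "has_psum m UNIV s \<Longrightarrow> m \<in> \<W>"
  by (simp add: \<W>_iff has_psum_psummable)

lemma unit_simps [simp]:
  "\<eta> x x = 1" "\<eta> \<natural> (Some \<sigma>) = 0" "\<eta> (Some \<sigma>) \<natural> = 0"
  by (simp_all add: unit_def)

lemma has_psum_unit: "has_psum (\<eta> x) UNIV 1"
  using has_psum_single[of x UNIV "\<eta> x"] by (auto simp: unit_def)

lemma unit_\<W> [simp]: "\<eta> x \<in> \<W>"
  using has_psum_unit by (rule has_psum_\<W>)

lemma mass_unit: "mass (\<eta> x) = 1"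
  using has_psum_mass[OF unit_\<W>] has_psum_unit by (rule has_psum_unique)

lemma lscale_\<W> [simp]: "m \<in> \<W> \<Longrightarrow> lscale u m \<in> \<W>"
  unfolding lscale_def by (rule has_psum_\<W>[OF has_psum_mult_left[OF has_psum_mass]])

text \<open>Merges the separate summand of \<open>dagger\<close> at \<natural> into one sum over all
  of \<open>'s option\<close>, to which the exchange law applies directly.\<close>

definition extend :: "('s \<Rightarrow> ('s, 'u::outcome_semiring) wfun) \<Rightarrow> 's option \<Rightarrow> ('s, 'u) wfun" where
  "extend k x = (case x of None \<Rightarrow> \<eta> \<natural> | Some \<sigma> \<Rightarrow> k \<sigma>)"

lemma extend_simps [simp]: "extend k \<natural> = \<eta> \<natural>" "extend k (Some \<sigma>) = k \<sigma>"
  by (simp_all add: extend_def)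

lemma extend_\<W> [simp]: "k \<in> kernels \<Longrightarrow> extend k x \<in> \<W>"
  by (cases x) (auto simp: kernels_def)

text \<open>Boundedness replaces any assumption on \<open>k\<close>: the products lie below
  \<open>m x * top\<close>, and multiplication by \<open>top\<close> distributes over the mass of
  \<open>m\<close>.\<close>

lemma psummable_weighted:
  assumes "m \<in> \<W>" shows "psummable (\<lambda>x. m x * k x) UNIV"
proof -
  have "psummable (\<lambda>x. m x * top) UNIV"
    using has_psum_mult_right[OF has_psum_mass[OF assms]] by (rule has_psum_psummable)
  then show ?thesis by (rule psummable_mono) (simp add: mult_left_mono_natural)
qed

text \<open>\<open>dagger\<close> is written with \<open>psum\<close> and \<open>tadd\<close>, which
  are meaningful only where defined; if \<open>m\<close> has a mass, both are, for every
  \<open>k\<close>.\<close>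

lemma has_psum_dagger:
  assumes m: "m \<in> \<W>"
  shows "has_psum (\<lambda>x. m x * extend k x y) UNIV (dagger k m y)"
proof -
  define g where "g x = m x * extend k x y" for x
  have g: "psummable g UNIV" unfolding g_def using m by (rule psummable_weighted)
  have UN: "UNIV = range Some \<union> {None :: 'a option}" by (auto simp: UNIV_option_conv)
  obtain t where t: "has_psum g (range Some) t"
    using psummable_has_psum[OF psummable_subset[OF g]] by blast
  have N: "has_psum g {None} (g None)" by (rule has_psum_single) auto
  obtain r where r: "padd t (g None) = Some r" "has_psum g UNIV r"
    using has_psum_union[OF _ _ t N] g UN by auto
  have "has_psum (\<lambda>\<sigma>. g (Some \<sigma>)) UNIV t" using t by (simp add: has_psum_reindex)
  then have "has_psum (\<lambda>\<sigma>. g (Some \<sigma>)) {\<sigma>. Some \<sigma> \<in> supp m} t"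
    by (subst has_psum_neutral[of _ UNIV]) (auto simp: supp_def g_def)
  then have "psum (\<lambda>\<sigma>. m (Some \<sigma>) * k \<sigma> y) {\<sigma>. Some \<sigma> \<in> supp m} = t"
    by (intro psum_eq) (simp add: g_def)
  then have "dagger k m y = r" using r(1) by (simp add: dagger_def tadd_def g_def)
  then show ?thesis using r(2) by (simp add: g_def[abs_def])
qed

lemma dagger_eqI:
  assumes "m \<in> \<W>" "\<And>y. has_psum (\<lambda>x. m x * extend k x y) UNIV (r y)"
  shows "dagger k m = r"
proof
  show "dagger k m y = r y" for y
    using has_psum_dagger[OF assms(1)] assms(2) by (rule has_psum_unique)
qed

text \<open>One double sum read in two orders: over the target states first, each row is a multiple
  of a mass; over the source states first, the columns are the values of
  \<open>dagger k m\<close>.\<close>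

lemma has_psum_dagger_mass:
  assumes m: "m \<in> \<W>" and k: "k \<in> kernels"
  shows "dagger k m \<in> \<W>" "has_psum (\<lambda>x. m x * mass (extend k x)) UNIV (mass (dagger k m))"
proof -
  obtain S where S: "has_psum (\<lambda>x. m x * mass (extend k x)) UNIV S"
    using psummable_has_psum[OF psummable_weighted[OF m, of "\<lambda>x. mass (extend k x)"]] by blast
  have "has_psum (dagger k m) UNIV S"
  proof (rule has_psum_swap[OF _ S])
    show "has_psum (\<lambda>y. m x * extend k x y) UNIV (m x * mass (extend k x))" for x
      using k by (intro has_psum_mult_left has_psum_mass) simp
    show "has_psum (\<lambda>x. m x * extend k x y) UNIV (dagger k m y)" for y
      using m by (rule has_psum_dagger)
  qed
  then show W: "dagger k m \<in> \<W>" by (rule has_psum_\<W>)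
  have "S = mass (dagger k m)"
    using \<open>has_psum (dagger k m) UNIV S\<close> has_psum_mass[OF W] by (rule has_psum_unique)
  then show "has_psum (\<lambda>x. m x * mass (extend k x)) UNIV (mass (dagger k m))" using S by simp
qed

lemma dagger_unit [simp]: "dagger k (\<eta> x) = extend k x"
proof (rule dagger_eqI)
  show "has_psum (\<lambda>z. \<eta> x z * extend k z y) UNIV (extend k x y)" for y
    using has_psum_single[of x UNIV "\<lambda>z. \<eta> x z * extend k z y"] by (simp add: unit_def)
qed simp

lemma has_psum_weighted_unit: "has_psum (\<lambda>x. m x * \<eta> x y) UNIV (m y)"
  using has_psum_single[of y UNIV "\<lambda>x. m x * \<eta> x y"] by (simp add: unit_def)

lemma extend_unit [simp]: "extend (\<lambda>\<sigma>. \<eta> (Some \<sigma>)) x = \<eta> x"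
  by (cases x) auto

lemma dagger_unit_right [simp]: "m \<in> \<W> \<Longrightarrow> dagger (\<lambda>\<sigma>. \<eta> (Some \<sigma>)) m = m"
  by (rule dagger_eqI) (simp_all add: has_psum_weighted_unit)

lemma dagger_lscale:
  assumes "m \<in> \<W>" shows "dagger k (lscale u m) = lscale u (dagger k m)"
proof (rule dagger_eqI)
  show "has_psum (\<lambda>x. lscale u m x * extend k x y) UNIV (lscale u (dagger k m) y)" for y
    using has_psum_mult_left[OF has_psum_dagger[OF assms]] by (simp add: lscale_def mult.assoc)
qed (use assms in simp)

text \<open>Associativity is an exchange of the sums over the initial \<open>x\<close> and the
  intermediate \<open>z\<close>; the factors \<open>m x\<close> and \<open>extend g z y\<close> are
  pulled out on either side by Scott continuity of multiplication.\<close>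

lemma dagger_assoc:
  assumes m: "m \<in> \<W>" and f: "f \<in> kernels"
  shows "dagger g (dagger f m) = dagger (\<lambda>\<sigma>. dagger g (f \<sigma>)) m"
proof (rule dagger_eqI)
  show "dagger f m \<in> \<W>" using m f by (rule has_psum_dagger_mass)
  fix y
  show "has_psum (\<lambda>z. dagger f m z * extend g z y) UNIV (dagger (\<lambda>\<sigma>. dagger g (f \<sigma>)) m y)"
  proof (rule has_psum_swap[OF _ has_psum_dagger[OF m]])
    fix x
    have "extend (\<lambda>\<sigma>. dagger g (f \<sigma>)) x = dagger g (extend f x)" by (cases x) auto
    then show "has_psum (\<lambda>z. m x * (extend f x z * extend g z y)) UNIV
        (m x * extend (\<lambda>\<sigma>. dagger g (f \<sigma>)) x y)"
      using f by (auto intro!: has_psum_mult_left has_psum_dagger)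
  next
    fix z
    show "has_psum (\<lambda>x. m x * (extend f x z * extend g z y)) UNIV (dagger f m z * extend g z y)"
      using has_psum_mult_right[OF has_psum_dagger[OF m]] by (simp add: mult.assoc)
  qed
qed

lemma has_wadd_wadd: "has_wadd m1 m2 m \<Longrightarrow> wadd m1 m2 = m"
  by (auto simp: has_wadd_def wadd_def tadd_def)

lemma has_wadd_unique: "has_wadd m1 m2 m \<Longrightarrow> has_wadd m1 m2 m' \<Longrightarrow> m = m'"
  using has_wadd_wadd by metis

lemma oplus_singletons: "{m1} \<oplus> {m2} = {m. has_wadd m1 m2 m}"
  by (auto simp: oplus_def)

lemma oplus_singletons_eq:
  assumes "has_wadd m1 m2 m" shows "{m1} \<oplus> {m2} = {m}"
proof -
  have "has_wadd m1 m2 m' \<longleftrightarrow> m' = m" for m' using assms by (metis has_wadd_unique)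
  then show ?thesis by (simp add: oplus_singletons)
qed

text \<open>Since \<open>top\<close> is idempotent, the weights \<open>u * top\<close> are the fixed
  points of right multiplication by \<open>top\<close>. In this equational form saturation passes
  through sums by distributivity.\<close>

lemma saturated_iff: "saturated m \<longleftrightarrow> m \<natural> * top = m \<natural>"
  unfolding saturated_def by (metis mult.assoc top_mult_top)

lemma saturated_unit: "saturated (\<eta> (Some \<sigma>))"
  by (simp add: saturated_iff unit_def)

lemma saturated_lscale: "saturated m \<Longrightarrow> saturated (lscale u m)"
  by (simp add: saturated_iff lscale_def mult.assoc)

lemma saturated_has_wadd:
  assumes "has_wadd m1 m2 m" "saturated m1" "saturated m2" shows "saturated m"
proof -
  have "padd (m1 \<natural>) (m2 \<natural>) = Some (m \<natural>)" using assms by (auto simp: has_wadd_def)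
  then show ?thesis
    using padd_distrib_right[of "m1 \<natural>" "m2 \<natural>" "m \<natural>" top] assms by (simp add: saturated_iff)
qed

lemma saturated_dagger:
  assumes m: "m \<in> \<W>" "saturated m" and k: "\<And>\<sigma>. saturated (k \<sigma>)"
  shows "saturated (dagger k m)"
proof -
  have "m x * extend k x \<natural> * top = m x * extend k x \<natural>" for x
    using m k by (cases x) (auto simp: saturated_iff unit_def mult.assoc)
  then have "has_psum (\<lambda>x. m x * extend k x \<natural>) UNIV (dagger k m \<natural> * top)"
    using has_psum_mult_right[OF has_psum_dagger[OF m(1)], of k "\<natural>" top] by simp
  then show ?thesis
    unfolding saturated_iff using has_psum_dagger[OF m(1)] has_psum_unique by blast
qed


section \<open>Loops\<close>

primrec kpow :: "('s \<Rightarrow> ('s, 'u::outcome_semiring) wfun) \<Rightarrow> nat \<Rightarrow> 's \<Rightarrow> ('s, 'u) wfun" where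
  "kpow K 0 = (\<lambda>\<sigma>. \<eta> (Some \<sigma>))"
| "kpow K (Suc n) = (\<lambda>\<sigma>. dagger K (kpow K n \<sigma>))"

lemma kpow_kernel: "K \<in> kernels \<Longrightarrow> kpow K n \<in> kernels"
  by (induction n) (auto simp: kernels_def has_psum_dagger_mass)

lemma kpow_\<W>: "K \<in> kernels \<Longrightarrow> kpow K n \<sigma> \<in> \<W>"
  using kpow_kernel by (auto simp: kernels_def)

text \<open>\<open>kpow\<close> appends a new round at the end, as the stages of the rule
  \<open>Iter\<close> do, whereas \<open>loop_fun\<close> prepends it; associativity reconciles the
  two.\<close>

lemma kpow_Suc_left:
  assumes K: "K \<in> kernels"
  shows "kpow K (Suc n) \<sigma> = dagger (kpow K n) (K \<sigma>)"
proof (induction n)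
  case 0
  then show ?case using K by (simp add: kernels_def)
next
  case (Suc n)
  have "kpow K (Suc (Suc n)) \<sigma> = dagger K (dagger (kpow K n) (K \<sigma>))" using Suc by simp
  also have "\<dots> = dagger (\<lambda>\<tau>. dagger K (kpow K n \<tau>)) (K \<sigma>)"
    using K kpow_kernel[OF K] by (intro dagger_assoc) (auto simp: kernels_def)
  finally show ?case by simp
qed

lemma kpow_saturated:
  "K \<in> kernels \<Longrightarrow> (\<And>\<tau>. saturated (K \<tau>)) \<Longrightarrow> saturated (kpow K n \<sigma>)"
  by (induction n) (auto intro: saturated_unit saturated_dagger kpow_\<W>)

locale loop =
  fixes c :: "'s \<Rightarrow> ('s, 'u::outcome_semiring) wfun" and e1 e2 :: "('s, 'u) guard"
  assumes body_kernel: "c \<in> kernels" and body_saturated: "\<And>\<sigma>. saturated (c \<sigma>)"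
    and step_defined: "\<And>f \<sigma>. f \<in> kernels \<Longrightarrow>
      \<exists>m. has_wadd (lscale (gval e1 \<sigma>) (dagger f (c \<sigma>))) (lscale (gval e2 \<sigma>) (\<eta> (Some \<sigma>))) m"
begin

definition K where "K \<sigma> = lscale (gval e1 \<sigma>) (c \<sigma>)"

definition F where "F n = (loop_fun e1 e2 c ^^ n) kernel_bot"

lemma K_kernel: "K \<in> kernels"
  using body_kernel by (simp add: kernels_def K_def)

lemma K_\<W>: "K \<sigma> \<in> \<W>"
  using K_kernel by (simp add: kernels_def)

lemma K_saturated: "saturated (K \<sigma>)"
  using body_saturated by (simp add: K_def saturated_lscale)

lemma loop_fun_step:
  assumes "f \<in> kernels"
  shows "has_wadd (dagger f (K \<sigma>)) (lscale (gval e2 \<sigma>) (\<eta> (Some \<sigma>))) (loop_fun e1 e2 c f \<sigma>)"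
proof -
  have "dagger f (K \<sigma>) = lscale (gval e1 \<sigma>) (dagger f (c \<sigma>))"
    unfolding K_def using body_kernel by (intro dagger_lscale) (simp add: kernels_def)
  then show ?thesis
    using step_defined[OF assms, of \<sigma>] has_wadd_wadd unfolding loop_fun_def by fastforce
qed

lemma F_kernel: "F n \<in> kernels"
proof (induction n)
  case 0
  then show ?case by (simp add: F_def kernels_def kernel_bot_def)
next
  case (Suc n)
  then show ?case using loop_fun_step[OF Suc] by (auto simp: F_def kernels_def has_wadd_def)
qed

lemma F_Suc: "has_wadd (dagger (F n) (K \<sigma>)) (lscale (gval e2 \<sigma>) (\<eta> (Some \<sigma>))) (F (Suc n) \<sigma>)"
  using loop_fun_step[OF F_kernel] by (simp add: F_def)

text \<open>At \<natural>, saturation of \<open>K \<sigma>\<close> absorbs the factor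
  \<open>top\<close>; at proper states the induction hypothesis supplies it, starting from the
  bottom element. The exit summand with \<open>e2\<close> is 0 at \<natural>.\<close>

lemma F_nonterm: "F n \<sigma> \<natural> = mass (kpow K n \<sigma>) * top"
proof (induction n arbitrary: \<sigma>)
  case 0
  then show ?case by (simp add: F_def kernel_bot_def lscale_def mass_unit)
next
  case (Suc n)
  have "K \<sigma> x * mass (extend (kpow K n) x) * top = K \<sigma> x * extend (F n) x \<natural>" for x
    using Suc K_saturated[of \<sigma>]
    by (cases x) (auto simp: saturated_iff mass_unit mult.assoc)
  then have "has_psum (\<lambda>x. K \<sigma> x * extend (F n) x \<natural>) UNIV (mass (kpow K (Suc n) \<sigma>) * top)"
    using has_psum_mult_right[OF has_psum_dagger_mass(2)[OF K_\<W> kpow_kernel[OF K_kernel]],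
        of \<sigma> n top]
    unfolding kpow_Suc_left[OF K_kernel] by simp
  then have "dagger (F n) (K \<sigma>) \<natural> = mass (kpow K (Suc n) \<sigma>) * top"
    using has_psum_dagger[OF K_\<W>] has_psum_unique by blast
  then show ?case
    using F_Suc[of n \<sigma>] by (auto simp: has_wadd_def lscale_def padd_zero_right dest!: spec[of _ "\<natural>"])
qed

text \<open>Besides its value, this gives the definedness of all initial sums of exit weights, from
  which summability over all rounds will follow.\<close>

lemma F_term: "fsum (\<lambda>k. kpow K k \<sigma> (Some y) * gval e2 y) {..<n} = Some (F n \<sigma> (Some y))"
proof (induction n arbitrary: \<sigma>)
  case 0
  then show ?case by (simp add: F_def kernel_bot_def lscale_def)
next
  case (Suc n)
  have "has_psum (\<lambda>k. kpow K (Suc k) \<sigma> (Some y) * gval e2 y) {..<n} (dagger (F n) (K \<sigma>) (Some y))"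
  proof (rule has_psum_swap[OF _ has_psum_dagger[OF K_\<W>]])
    fix x
    show "has_psum (\<lambda>k. K \<sigma> x * (extend (kpow K k) x (Some y) * gval e2 y)) {..<n}
        (K \<sigma> x * extend (F n) x (Some y))"
    proof (rule has_psum_mult_left, cases x)
      case None
      then show "has_psum (\<lambda>k. extend (kpow K k) x (Some y) * gval e2 y) {..<n} (extend (F n) x (Some y))"
        by (simp add: has_psum_zero)
    next
      case (Some \<tau>)
      then show "has_psum (\<lambda>k. extend (kpow K k) x (Some y) * gval e2 y) {..<n} (extend (F n) x (Some y))"
        using Suc[of \<tau>] has_psum_finite by force
    qed
  next
    fix k
    show "has_psum (\<lambda>x. K \<sigma> x * (extend (kpow K k) x (Some y) * gval e2 y)) UNIV
        (kpow K (Suc k) \<sigma> (Some y) * gval e2 y)"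
      unfolding kpow_Suc_left[OF K_kernel]
      using has_psum_mult_right[OF has_psum_dagger[OF K_\<W>]] by (simp add: mult.assoc)
  qed
  then have tail: "fsum (\<lambda>k. kpow K (Suc k) \<sigma> (Some y) * gval e2 y) {..<n} =
      Some (dagger (F n) (K \<sigma>) (Some y))"
    by (rule has_psum_finiteD[rotated]) simp
  \<comment> \<open>The summand \<open>k = 0\<close> is the immediate exit. It vanishes unless
    \<open>y = \<sigma>\<close>, and unit entries are 0 or 1, so it agrees with the
    \<open>e2\<close> summand of \<open>loop_fun\<close> despite the order of the factors.\<close>
  have "fsum (\<lambda>k. kpow K k \<sigma> (Some y) * gval e2 y) {..<Suc n} =
      oadd (Some (\<eta> (Some \<sigma>) (Some y) * gval e2 y))
        (fsum (\<lambda>k. kpow K (Suc k) \<sigma> (Some y) * gval e2 y) {..<n})"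
    unfolding lessThan_Suc_eq_insert_0 by (subst fsum_insert) (auto simp: fsum_reindex)
  also have "\<dots> = padd (dagger (F n) (K \<sigma>) (Some y)) (gval e2 \<sigma> * \<eta> (Some \<sigma>) (Some y))"
    unfolding tail by (subst padd_commute) (simp add: unit_def del: kpow.simps)
  also have "\<dots> = Some (F (Suc n) \<sigma> (Some y))"
    using F_Suc[of n \<sigma>] by (simp add: has_wadd_def lscale_def)
  finally show ?case .
qed

end

section \<open>The supremum of the Kleene iterates\<close>

context loop
begin

lemma F_le_lub:
  assumes "is_kernel_lub (range F) f"
  shows "F n \<sigma> (Some y) \<le> f \<sigma> (Some y)" "f \<sigma> \<natural> \<le> F n \<sigma> \<natural>"
  using assms by (auto simp: is_kernel_lub_def kernel_le_def fusion_le_def)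

text \<open>
  The weights \<open>t \<sigma> x k\<close> are summable over pairs \<open>(x, k)\<close> because any finite set of pairs is dominated
  by one iterate \<open>F (Suc n) \<sigma>\<close>; hence \<open>g\<close> has a mass and is an upper bound of the chain in \<open>kernels\<close>.
\<close>

lemma loop_lub:
  assumes lub: "is_kernel_lub (range F) f" and l: "\<And>\<sigma> n. l \<sigma> \<le> F n \<sigma> \<natural>"
  shows "l \<sigma> \<le> f \<sigma> \<natural>"
    and "has_psum (\<lambda>k. kpow K k \<sigma> (Some y) * gval e2 y) UNIV (f \<sigma> (Some y))"
proof -
  \<comment> \<open>The whole weight of row \<natural> is put into the cell \<open>k = 0\<close>, so
    every block of columns containing 0 already sums to \<open>l \<sigma>\<close> there.\<close>
  define t where "t \<sigma> x k = (case x of None \<Rightarrow> if k = 0 then l \<sigma> else 0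
      | Some y \<Rightarrow> kpow K k \<sigma> (Some y) * gval e2 y)" for \<sigma> x and k :: nat
  define g where "g \<sigma> x = (case x of None \<Rightarrow> l \<sigma>
      | Some y \<Rightarrow> psum (\<lambda>k. kpow K k \<sigma> (Some y) * gval e2 y) UNIV)" for \<sigma> x
  have t_Some: "t \<sigma> (Some y) = (\<lambda>k. kpow K k \<sigma> (Some y) * gval e2 y)" for \<sigma> y
    by (simp add: t_def[abs_def])
  have t0: "has_psum (t \<sigma> None) A (l \<sigma>)" if "0 \<in> A" for \<sigma> A
    using has_psum_single[of 0 A "t \<sigma> None"] that by (simp add: t_def)
  have g: "has_psum (t \<sigma> x) UNIV (g \<sigma> x)" for \<sigma> x
  proof (cases x)
    case None
    then show ?thesis using t0 by (simp add: g_def)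
  next
    case (Some y)
    have "psummable (t \<sigma> x) UNIV"
      unfolding Some t_Some by (rule psummable_nat) (simp add: F_term)
    then obtain r where r: "has_psum (t \<sigma> x) UNIV r" by (auto dest: psummable_has_psum)
    then show ?thesis using psum_eq[OF r] Some by (simp add: g_def t_Some)
  qed
  have le_g: "F n \<sigma> (Some y) \<le> g \<sigma> (Some y)" for n \<sigma> y
    using has_psum_upper[OF g, of "{..<n}" \<sigma> "Some y"] F_term[of \<sigma> y n] by (simp add: t_Some)
  have g_le: "g \<sigma> (Some y) \<le> f \<sigma> (Some y)" for \<sigma> y
  proof (rule has_psum_least[OF g])
    fix N :: "nat set" assume "finite N"
    then obtain n where "N \<subseteq> {..<n}" by (auto simp: finite_nat_iff_bounded)
    then have "ole (fsum (t \<sigma> (Some y)) N) (fsum (t \<sigma> (Some y)) {..<n})"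
      by (intro fsum_mono_set) auto
    moreover have "fsum (t \<sigma> (Some y)) {..<n} = Some (F n \<sigma> (Some y))"
      by (simp add: t_Some F_term)
    moreover have "ole (Some (F n \<sigma> (Some y))) (Some (f \<sigma> (Some y)))"
      using F_le_lub(1)[OF lub] by simp
    ultimately show "ole (fsum (t \<sigma> (Some y)) N) (Some (f \<sigma> (Some y)))"
      using ole_trans by metis
  qed
  have "g \<sigma> \<in> \<W>" for \<sigma>
  proof -
    \<comment> \<open>\<open>{..<Suc n}\<close> always contains column 0, so the row sums are given
      by \<open>s\<close>; they lie below \<open>F (Suc n) \<sigma>\<close>, which has a
      mass.\<close>
    have sum: "psummable (case_prod (t \<sigma>)) (UNIV \<times> {..<Suc n})" for n
    proof (rule psummable_Sigma)
      define s where "s x = (case x of None \<Rightarrow> l \<sigma> | Some y \<Rightarrow> F (Suc n) \<sigma> (Some y))" for x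
      show "has_psum (t \<sigma> x) {..<Suc n} (s x)" for x
      proof (cases x)
        case None
        then show ?thesis using t0 by (simp add: s_def)
      next
        case (Some y)
        then show ?thesis
          using has_psum_finite[OF _ F_term[of \<sigma> y "Suc n"]] by (simp add: s_def t_Some)
      qed
      have "F (Suc n) \<sigma> \<in> \<W>" using F_kernel by (auto simp: kernels_def)
      then show "psummable s UNIV"
        unfolding \<W>_iff by (rule psummable_mono) (auto simp: s_def l split: option.split)
    qed
    have "psummable (case_prod (t \<sigma>)) (UNIV \<times> UNIV)"
      unfolding psummable_def
    proof (intro conjI allI impI)
      \<comment> \<open>Countability is borrowed from \<open>f\<close>: by \<open>g_le\<close>,
        proper states with a nonzero entry lie in its support.\<close>
      have "f \<sigma> x \<noteq> 0" if nz: "t \<sigma> x k \<noteq> 0" "x \<noteq> None" for x k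
      proof -
        obtain y where y: "x = Some y" using nz by auto
        have "ole (fsum (t \<sigma> x) {k}) (Some (g \<sigma> x))" by (intro has_psum_upper[OF g]) auto
        then have "t \<sigma> x k \<le> g \<sigma> x" by (simp add: padd_zero_right)
        also have "\<dots> \<le> f \<sigma> x" using g_le by (simp add: y)
        finally show ?thesis using nz by auto
      qed
      then have "{p \<in> UNIV \<times> UNIV. case_prod (t \<sigma>) p \<noteq> 0} \<subseteq> insert None {x. f \<sigma> x \<noteq> 0} \<times> UNIV"
        by auto
      moreover have "countable (insert None {x. f \<sigma> x \<noteq> 0})"
        using lub by (auto simp: is_kernel_lub_def kernels_def \<W>_iff psummable_def)
      ultimately show "countable {p \<in> UNIV \<times> UNIV. case_prod (t \<sigma>) p \<noteq> 0}"
        by (meson countable_SIGMA countable_subset countableI_type)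
      fix G :: "('s option \<times> nat) set" assume G: "finite G \<and> G \<subseteq> UNIV \<times> UNIV"
      then have "finite (snd ` G)" by simp
      then obtain n where "snd ` G \<subseteq> {..<n}" by (auto simp: finite_nat_iff_bounded)
      then have "G \<subseteq> UNIV \<times> {..<Suc n}" by force
      then show "fsum (case_prod (t \<sigma>)) G \<noteq> None" using G psummableD[OF sum] by blast
    qed
    then obtain S where "has_psum (g \<sigma>) UNIV S"
      using has_psum_Sigma_iterate[of "t \<sigma>" UNIV "\<lambda>_. UNIV" "g \<sigma>"] g by blast
    then show ?thesis by (rule has_psum_\<W>)
  qed
  then have "g \<in> kernels" by (simp add: kernels_def)
  moreover have "kernel_le (F n) g" for n
    using le_g l by (simp add: kernel_le_def fusion_le_def g_def)
  \<comment> \<open>The fusion order is reversed at \<natural>, so this one comparison bounds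
    \<open>f\<close> from below there and from above at proper states.\<close>
  ultimately have fg: "kernel_le f g" using lub by (auto simp: is_kernel_lub_def)
  then show "l \<sigma> \<le> f \<sigma> \<natural>" by (simp add: kernel_le_def fusion_le_def g_def)
  have "f \<sigma> (Some y) \<le> g \<sigma> (Some y)" using fg by (simp add: kernel_le_def fusion_le_def)
  then have "g \<sigma> (Some y) = f \<sigma> (Some y)" using g_le by (intro antisym)
  then show "has_psum (\<lambda>k. kpow K k \<sigma> (Some y) * gval e2 y) UNIV (f \<sigma> (Some y))"
    using g[of \<sigma> "Some y"] by (simp add: t_Some)
qed

text \<open>The competitor has nontermination weight \<open>f \<tau> \<natural> * top\<close>, which
  stays below every iterate because the iterates are already multiples of \<open>top\<close> at
  \<natural>.\<close>

lemma loop_saturated: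
  assumes lub: "is_kernel_lub (range F) f"
  shows "saturated (f \<sigma>)"
proof -
  have "f \<tau> \<natural> * top \<le> F n \<tau> \<natural>" for \<tau> n
  proof -
    have "f \<tau> \<natural> * top \<le> F n \<tau> \<natural> * top" by (intro mult_right_mono_natural F_le_lub(2)[OF lub])
    then show ?thesis by (simp add: F_nonterm mult.assoc top_mult_top)
  qed
  then have "f \<sigma> \<natural> * top \<le> f \<sigma> \<natural>" using loop_lub(1)[OF lub, of "\<lambda>\<tau>. f \<tau> \<natural> * top"] by blast
  moreover have "f \<sigma> \<natural> * 1 \<le> f \<sigma> \<natural> * top" by (rule mult_left_mono_natural) simp
  ultimately show ?thesis by (simp add: saturated_iff)
qed

lemma loop_nonterm_glb:
  assumes lub: "is_kernel_lub (range F) f"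
  shows "is_glb (range (\<lambda>n. mass (kpow K n \<sigma>) * top)) (f \<sigma> \<natural>)"
  unfolding is_glb_def F_nonterm[symmetric]
proof (intro conjI ballI allI impI)
  fix y assume y: "\<forall>s\<in>range (\<lambda>n. F n \<sigma> \<natural>). y \<le> s"
  \<comment> \<open>The bound \<open>y\<close> is known for \<sigma> only, so the competitor keeps
    the weight of \<open>f\<close> at all other states.\<close>
  have "(if \<tau> = \<sigma> then y else f \<tau> \<natural>) \<le> F n \<tau> \<natural>" for \<tau> n
    using y F_le_lub(2)[OF lub] by auto
  then show "y \<le> f \<sigma> \<natural>"
    using loop_lub(1)[OF lub, of "\<lambda>\<tau>. if \<tau> = \<sigma> then y else f \<tau> \<natural>" \<sigma>] by simp
qed (use F_le_lub(2)[OF lub] in auto)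

lemma loop_term_sum:
  "is_kernel_lub (range F) f \<Longrightarrow>
    has_psum (\<lambda>k. kpow K k \<sigma> (Some y) * gval e2 y) UNIV (f \<sigma> (Some y))"
  using loop_lub(2)[of f "\<lambda>_. 0"] by simp

end


section \<open>Derivability\<close>

text \<open>This is where saturation enters: the summand at \<natural> is an instance of
  \<open>Div\<close>, the others are scaled unit triples. \<open>Scale\<close> multiplies on the
  left, as \<open>dagger\<close> does with the weights of \<open>m\<close>.\<close>

lemma derivable_dagger:
  assumes k: "\<And>\<sigma>. derivable \<Omega> {\<eta> (Some \<sigma>)} C {k \<sigma>}" and kernel: "k \<in> kernels"
    and m: "m \<in> \<W>" "saturated m"
  shows "derivable \<Omega> {m} C {dagger k m}"
proof -
  \<comment> \<open>States are coded in the fixed index type of \<open>Choice\<close> by their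
    units; the other two components are fillers.\<close>
  define idx :: "'a option \<Rightarrow> ('a, 'b) index" where "idx x = (0, {\<eta> x}, {})" for x
  define J where "J = inv_into (supp m) idx"
  have "inj_on idx (supp m)"
  proof (rule inj_onI)
    fix x y assume x: "x \<in> supp m" and "idx x = idx y"
    then have "\<eta> x = (\<eta> y :: ('a, 'b) wfun)" by (simp add: idx_def)
    from fun_cong[OF this, of x] have "\<eta> y x = (1 :: 'b)" by simp
    \<comment> \<open>If 0 = 1, all weights vanish and all units coincide; an element of the support
      rules this out.\<close>
    moreover have "(0 :: 'b) \<noteq> 1"
    proof
      assume "(0 :: 'b) = 1"
      then have "m x * 0 = m x * 1" by simp
      then show "False" using x by (simp add: supp_def)
    qed
    ultimately show "x = y" by (auto simp: unit_def split: if_splits)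
  qed
  then have inj: "inj_on idx (supp m)" and J: "\<And>x. x \<in> supp m \<Longrightarrow> J (idx x) = x"
    by (auto simp: J_def)
  have reindex: "has_psum (\<lambda>t. m (J t) * h (J t)) (idx ` supp m) s \<longleftrightarrow>
      has_psum (\<lambda>x. m x * h x) UNIV s" for h s
  proof -
    have "has_psum (\<lambda>t. m (J t) * h (J t)) (idx ` supp m) s \<longleftrightarrow>
        has_psum (\<lambda>x. m (J (idx x)) * h (J (idx x))) (supp m) s"
      using inj by (rule has_psum_reindex)
    also have "\<dots> \<longleftrightarrow> has_psum (\<lambda>x. m x * h x) (supp m) s"
      by (rule has_psum_cong) (simp add: J)
    also have "\<dots> \<longleftrightarrow> has_psum (\<lambda>x. m x * h x) UNIV s"
      by (rule has_psum_neutral) (auto simp: supp_def)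
    finally show ?thesis .
  qed
  let ?T = "idx ` supp m"
  let ?pre = "\<lambda>t. {lscale (m (J t)) (\<eta> (J t))}"
  let ?post = "\<lambda>t. {lscale (m (J t)) (extend k (J t))}"
  have weighted: "derivable \<Omega> {lscale (m x) (\<eta> x)} C {lscale (m x) (extend k x)}" for x
  proof (cases x)
    case None
    then show ?thesis
      using derivable.Div[of \<Omega> "m \<natural>" C] m(2) by (simp add: diverges_def saturated_iff)
  next
    case (Some \<sigma>)
    then show ?thesis
      using derivable.Scale[OF k[of \<sigma>], of "m x"] by (simp add: lscale_assn_def)
  qed
  have choice: "derivable \<Omega> (bigoplus ?T ?pre) C (bigoplus ?T ?post)"
    by (rule derivable.Choice) (rule weighted)
  have pre: "{m} \<subseteq> bigoplus ?T ?pre"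
  proof -
    have "has_wsum (\<lambda>t. lscale (m (J t)) (\<eta> (J t))) ?T m"
      using m reindex[of "\<lambda>z. \<eta> z y" for y] by (simp add: has_wsum_def lscale_def has_psum_weighted_unit)
    then show ?thesis
      by (auto simp: bigoplus_def intro!: exI[of _ "\<lambda>t. lscale (m (J t)) (\<eta> (J t))"])
  qed
  \<comment> \<open>The pieces are singletons and sums are unique, so the only possible sum of the
    family is \<open>dagger k m\<close>.\<close>
  have post: "bigoplus ?T ?post \<subseteq> {dagger k m}"
  proof
    fix m' assume "m' \<in> bigoplus ?T ?post"
    then obtain M where M': "\<forall>t\<in>?T. M t \<in> ?post t" and wsum: "has_wsum M ?T m'"
      unfolding bigoplus_def mem_Collect_eq by (elim exE conjE)
    have M: "M t = lscale (m (J t)) (extend k (J t))" if "t \<in> ?T" for t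
      using bspec[OF M' that] by simp
    have sum: "has_psum (\<lambda>t. M t y) ?T (m' y)" for y using wsum by (simp add: has_wsum_def)
    have "has_psum (\<lambda>x. m x * extend k x y) UNIV (m' y)" for y
    proof -
      have "has_psum (\<lambda>t. m (J t) * extend k (J t) y) ?T (m' y)"
        using sum[of y] has_psum_cong[of ?T "\<lambda>t. M t y" "\<lambda>t. m (J t) * extend k (J t) y"] M
        by (simp add: lscale_def)
      then show ?thesis using reindex[of "\<lambda>z. extend k z y"] by simp
    qed
    then show "m' \<in> {dagger k m}" using dagger_eqI[OF m(1)] by blast
  qed
  show ?thesis
    by (rule derivable.Consequence[OF pre choice post])
      (simp add: has_psum_dagger_mass(1)[OF m(1) kernel])
qed

section \<open>Terminating and nonterminating parts, guards, and the loop rule\<close>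

definition fin_part :: "('s, 'u::outcome_semiring) wfun \<Rightarrow> ('s, 'u) wfun" where
  "fin_part m x = (case x of None \<Rightarrow> 0 | Some y \<Rightarrow> m (Some y))"

lemma fin_part_simps [simp]: "fin_part m \<natural> = 0" "fin_part m (Some y) = m (Some y)"
  by (simp_all add: fin_part_def)

definition div_part :: "('s, 'u::outcome_semiring) wfun \<Rightarrow> ('s, 'u) wfun" where
  "div_part m = lscale (m \<natural>) (\<eta> \<natural>)"

lemma fin_part_\<W> [simp]: "m \<in> \<W> \<Longrightarrow> fin_part m \<in> \<W>"
  by (erule \<W>_mono) (simp add: fin_part_def split: option.split)

lemma div_part_\<W> [simp]: "div_part m \<in> \<W>"
  by (simp add: div_part_def)

lemma supp_div_part: "supp (div_part m) \<subseteq> {\<natural>}"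
  by (auto simp: supp_def div_part_def lscale_def unit_def split: if_splits)

lemma has_wadd_parts: "m \<in> \<W> \<Longrightarrow> has_wadd (fin_part m) (div_part m) m"
  by (auto simp: has_wadd_def div_part_def lscale_def fin_part_def padd_zero padd_zero_right
      split: option.split)

lemma dagger_assume:
  assumes "p \<in> \<W>" "p \<natural> = 0"
  shows "dagger (\<lambda>\<sigma>. lscale (w \<sigma>) (\<eta> (Some \<sigma>))) p =
    (\<lambda>x. case x of None \<Rightarrow> 0 | Some y \<Rightarrow> p (Some y) * w y)"
proof (rule dagger_eqI[OF assms(1)])
  fix y
  let ?h = "\<lambda>x. p x * extend (\<lambda>\<sigma>. lscale (w \<sigma>) (\<eta> (Some \<sigma>))) x y"
  have "?h x = 0" if "x \<noteq> y" for x
    using that assms(2) by (cases x) (auto simp: lscale_def unit_def)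
  then have "has_psum ?h UNIV (?h y)" by (intro has_psum_single) auto
  then show "has_psum ?h UNIV (case y of None \<Rightarrow> 0 | Some y \<Rightarrow> p (Some y) * w y)"
    using assms(2) by (cases y) (auto simp: lscale_def)
qed

text \<open>A unit trivially has a constant guard value on its support. The rule scales on the
  right, but the entries 0 and 1 commute with every weight.\<close>

lemma derivable_assume_unit:
  "derivable \<Omega> {\<eta> (Some \<sigma>)} (Assume e) {lscale (gval e \<sigma>) (\<eta> (Some \<sigma>))}"
proof -
  have "entails_eq {\<eta> (Some \<sigma>)} e (gval e \<sigma>)"
    by (auto simp: entails_eq_def supp_def unit_def split: if_splits)
  then have "derivable \<Omega> {\<eta> (Some \<sigma>)} (Assume e) (rscale_assn {\<eta> (Some \<sigma>)} (gval e \<sigma>))"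
    by (intro derivable.Assume) auto
  moreover have "rscale (\<eta> (Some \<sigma>)) (gval e \<sigma>) = lscale (gval e \<sigma>) (\<eta> (Some \<sigma>))"
    by (intro ext) (simp add: rscale_def lscale_def unit_def)
  ultimately show ?thesis by (simp add: rscale_assn_def)
qed

lemma least_fixpoint_unique:
  assumes "is_least_fixpoint \<Phi> f" "is_least_fixpoint \<Phi> g" shows "f = g"
proof (intro ext)
  fix \<sigma> x
  have "kernel_le f g" "kernel_le g f" using assms by (auto simp: is_least_fixpoint_def)
  then show "f \<sigma> x = g \<sigma> x"
    by (cases x) (auto simp: kernel_le_def fusion_le_def intro: antisym)
qed

text \<open>With singletons for all assertions, \<open>converges\<close> and
  \<open>divergence_limit\<close> each concern a single sequence, and the sum of the two parts at
  stage \<open>n\<close> collapses to \<open>{m n}\<close>.\<close>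

lemma (in loop) derivable_loop:
  assumes lub: "is_kernel_lub (range F) f"
    and body: "\<And>\<sigma>. derivable \<Omega> {\<eta> (Some \<sigma>)} C {c \<sigma>}"
  shows "derivable \<Omega> {\<eta> (Some \<sigma>)} (Iter C e1 e2) {f \<sigma>}"
proof -
  define m where "m n = kpow K n \<sigma>" for n
  have m: "m n \<in> \<W>" "saturated (m n)" for n
    by (simp_all add: m_def kpow_\<W>[OF K_kernel] kpow_saturated[OF K_kernel K_saturated])
  have f: "f \<sigma> \<in> \<W>" using lub by (auto simp: is_kernel_lub_def kernels_def)
  have split: "{fin_part (m n)} \<oplus> {div_part (m n)} = {m n}" for n
    using m by (intro oplus_singletons_eq has_wadd_parts)
  define A where "A \<tau> = lscale (gval e2 \<tau>) (\<eta> (Some \<tau>))" for \<tau>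
  have "derivable \<Omega> ({fin_part (m 0)} \<oplus> {div_part (m 0)}) (Iter C e1 e2)
      ({fin_part (f \<sigma>)} \<oplus> {div_part (f \<sigma>)})"
  proof (rule derivable.Iter)
    show "converges (\<lambda>n. {dagger A (fin_part (m n))}) {fin_part (f \<sigma>)}"
      unfolding converges_def
    proof (intro allI impI bexI)
      fix M assume "\<forall>n. M n \<in> {dagger A (fin_part (m n))}"
      then have M: "M n = (\<lambda>x. case x of None \<Rightarrow> 0 | Some y \<Rightarrow> m n (Some y) * gval e2 y)" for n
        using dagger_assume[OF fin_part_\<W>[OF m(1)]] by (simp add: A_def[abs_def])
      have "has_psum (\<lambda>n. M n x) UNIV (fin_part (f \<sigma>) x)" for x
        using loop_term_sum[OF lub] by (cases x) (auto simp: M m_def intro: has_psum_zero)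
      then show "has_wsum M UNIV (fin_part (f \<sigma>))" using f by (simp add: has_wsum_def)
    qed simp
    show "divergence_limit (\<lambda>n. {fin_part (m n)} \<oplus> {div_part (m n)}) {div_part (f \<sigma>)}"
      unfolding divergence_limit_def split
    proof (intro allI impI exI conjI)
      fix M assume "\<forall>n. M n \<in> {m n}"
      then show "is_glb (range (\<lambda>n. mass (M n) * top)) (f \<sigma> \<natural>)"
        using loop_nonterm_glb[OF lub] by (simp add: m_def)
    qed (simp add: div_part_def)
    show "derivable \<Omega> ({fin_part (m n)} \<oplus> {div_part (m n)}) (cmd.Seq (cmd.Assume e1) C)
        ({fin_part (m (Suc n))} \<oplus> {div_part (m (Suc n))})" for n
    proof -
      have "derivable \<Omega> {\<eta> (Some \<tau>)} (cmd.Seq (cmd.Assume e1) C) {K \<tau>}" for \<tau>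
        using derivable.Scale[OF body[of \<tau>], of "gval e1 \<tau>"]
        by (intro derivable.Seq[OF derivable_assume_unit]) (simp add: lscale_assn_def K_def)
      \<comment> \<open>\<open>m n\<close> may carry nonterminating weight from earlier rounds; its
        saturation makes \<open>derivable_dagger\<close> applicable.\<close>
      then have "derivable \<Omega> {m n} (cmd.Seq (cmd.Assume e1) C) {dagger K (m n)}"
        using K_kernel m by (intro derivable_dagger)
      then show ?thesis unfolding split by (simp add: m_def)
    qed
    show "derivable \<Omega> {fin_part (m n)} (cmd.Assume e2) {dagger A (fin_part (m n))}" for n
    proof (rule derivable_dagger)
      show "A \<in> kernels" by (simp add: A_def kernels_def)
      show "derivable \<Omega> {\<eta> (Some \<tau>)} (cmd.Assume e2) {A \<tau>}" for \<tau>
        unfolding A_def by (rule derivable_assume_unit)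
    qed (use m in \<open>simp_all add: saturated_iff\<close>)
  qed (use f supp_div_part in \<open>simp_all add: entails_true_def entails_div_def supp_def\<close>)
  moreover have "{fin_part (f \<sigma>)} \<oplus> {div_part (f \<sigma>)} = {f \<sigma>}"
    using f by (intro oplus_singletons_eq has_wadd_parts)
  ultimately show ?thesis by (simp only: split) (simp add: m_def)
qed

text \<open>Kernel membership and saturation belong to the induction claim because
  \<open>derivable_dagger\<close> is applied to intermediate results: after the first command of a
  sequence, and to Kleisli powers of a loop body.\<close>

lemma derivable_unit:
  fixes I :: "'a \<Rightarrow> 's \<Rightarrow> ('s, 'u::outcome_semiring) wfun"
  assumes interp: "\<And>a \<sigma>. I a \<sigma> \<in> \<W> \<and> saturated (I a \<sigma>)"
    and atomic: "\<And>\<phi>' a \<psi>'. \<phi>' \<subseteq> \<W> \<Longrightarrow> \<psi>' \<subseteq> \<W> \<Longrightarrow> valid I \<phi>' (Act a) \<psi>' \<Longrightarrow> (\<phi>', a, \<psi>') \<in> \<Omega>"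
    and wd: "well_defined I C"
  shows "denote I C \<in> kernels \<and>
    (\<forall>\<sigma>. saturated (denote I C \<sigma>) \<and> derivable \<Omega> {\<eta> (Some \<sigma>)} C {denote I C \<sigma>})"
  using wd
proof (induction C)
  case Skip
  then show ?case by (auto simp: kernels_def saturated_unit intro: derivable.Skip)
next
  case (Assume e)
  then show ?case
    by (auto simp: kernels_def saturated_unit saturated_lscale derivable_assume_unit)
next
  case (Act a)
  have "derivable \<Omega> {\<eta> (Some \<sigma>)} (Act a) {I a \<sigma>}" for \<sigma>
    using interp by (intro derivable.Axiom atomic) (auto simp: valid_def)
  then show ?case using interp by (auto simp: kernels_def)
next
  case (Seq C1 C2)
  then have 1: "denote I C1 \<sigma> \<in> \<W>" "saturated (denote I C1 \<sigma>)"
      "derivable \<Omega> {\<eta> (Some \<sigma>)} C1 {denote I C1 \<sigma>}"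
    and 2: "denote I C2 \<in> kernels" "saturated (denote I C2 \<sigma>)"
      "derivable \<Omega> {\<eta> (Some \<sigma>)} C2 {denote I C2 \<sigma>}" for \<sigma>
    by (auto simp: kernels_def)
  have "derivable \<Omega> {\<eta> (Some \<sigma>)} (cmd.Seq C1 C2) {dagger (denote I C2) (denote I C1 \<sigma>)}" for \<sigma>
    using 1 2 by (intro derivable.Seq[OF 1(3)] derivable_dagger)
  moreover have "saturated (dagger (denote I C2) (denote I C1 \<sigma>))" for \<sigma>
    using 1 2 by (intro saturated_dagger)
  moreover have "dagger (denote I C2) (denote I C1 \<sigma>) \<in> \<W>" for \<sigma>
    using 1 2 by (intro has_psum_dagger_mass)
  ultimately show ?case by (simp add: kernels_def)
next
  case (Plus C1 C2)
  have "wadd (denote I C1 \<sigma>) (denote I C2 \<sigma>) \<in> \<W> \<and>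
      saturated (wadd (denote I C1 \<sigma>) (denote I C2 \<sigma>)) \<and>
      derivable \<Omega> {\<eta> (Some \<sigma>)} (cmd.Plus C1 C2) {wadd (denote I C1 \<sigma>) (denote I C2 \<sigma>)}" for \<sigma>
  proof -
    have C1: "saturated (denote I C1 \<sigma>)" "derivable \<Omega> {\<eta> (Some \<sigma>)} C1 {denote I C1 \<sigma>}"
      and C2: "saturated (denote I C2 \<sigma>)" "derivable \<Omega> {\<eta> (Some \<sigma>)} C2 {denote I C2 \<sigma>}"
      using Plus by auto
    obtain m where m: "has_wadd (denote I C1 \<sigma>) (denote I C2 \<sigma>) m" using Plus.prems by auto
    \<comment> \<open>\<open>Plus\<close> excludes nontermination in its precondition; working with
      units of proper states meets this automatically.\<close>
    have "entails_true {\<eta> (Some \<sigma>) :: ('s, 'u) wfun}" by (simp add: entails_true_def supp_def)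
    then have "derivable \<Omega> {\<eta> (Some \<sigma>)} (cmd.Plus C1 C2) ({denote I C1 \<sigma>} \<oplus> {denote I C2 \<sigma>})"
      using C1(2) C2(2) by (rule derivable.Plus)
    then show ?thesis
      using m C1(1) C2(1) oplus_singletons_eq[OF m] has_wadd_wadd[OF m] saturated_has_wadd[OF m]
      by (simp add: has_wadd_def)
  qed
  then show ?case by (simp add: kernels_def)
next
  case (Iter C e1 e2)
  then interpret loop "denote I C" e1 e2 by unfold_locales auto
  \<comment> \<open>One witness is both the least fixed point, which evaluates the definite
    description, and the Kleene supremum, to which the loop lemmas apply.\<close>
  obtain f where lfp: "is_least_fixpoint (loop_fun e1 e2 (denote I C)) f"
    and lub: "is_kernel_lub (range F) f"
    using Iter.prems by (auto simp: F_def[abs_def])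
  have "denote I (cmd.Iter C e1 e2) = f"
    using lfp least_fixpoint_unique by (auto intro!: the_equality)
  moreover have "f \<in> kernels" using lfp by (simp add: is_least_fixpoint_def)
  moreover have "derivable \<Omega> {\<eta> (Some \<sigma>)} (cmd.Iter C e1 e2) {f \<sigma>}" for \<sigma>
    using Iter by (intro derivable_loop[OF lub]) auto
  ultimately show ?case using loop_saturated[OF lub] by simp
qed

theorem mainTheorem2:
  fixes I :: "'a \<Rightarrow> 's \<Rightarrow> ('s, 'u::outcome_semiring) wfun"
    and C :: "('a, 's, 'u) cmd"
    and \<phi> \<psi> :: "('s, 'u) assn"
    and \<Omega> :: "(('s, 'u) assn \<times> 'a \<times> ('s, 'u) assn) set"
  assumes interp: "\<And>a \<sigma>. I a \<sigma> \<in> \<W> \<and> saturated (I a \<sigma>)"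
    and atomic_axioms: "\<And>\<phi>' a \<psi>'. \<phi>' \<subseteq> \<W> \<Longrightarrow> \<psi>' \<subseteq> \<W> \<Longrightarrow> valid I \<phi>' (Act a) \<psi>' \<Longrightarrow> (\<phi>', a, \<psi>') \<in> \<Omega>"
    and wd: "well_defined I C"
    and pre: "\<phi> \<subseteq> \<W>" "\<And>m. m \<in> \<phi> \<Longrightarrow> saturated m"
    and post: "\<psi> \<subseteq> \<W>"
    and valid: "valid I \<phi> C \<psi>"
  shows "derivable \<Omega> \<phi> C \<psi>"
proof -
  have unit: "denote I C \<in> kernels" "\<And>\<sigma>. derivable \<Omega> {\<eta> (Some \<sigma>)} C {denote I C \<sigma>}"
    using derivable_unit[of I \<Omega> C] interp atomic_axioms wd by blast+
  \<comment> \<open>Each \<open>m\<close> is coded by its own singleton precondition, so the family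
    can be read off from the index; the outer components are fillers.\<close>
  let ?T = "(\<lambda>m. (0, {m}, {})) ` \<phi> :: ('s, 'u) index set"
  let ?pre = "\<lambda>t :: ('s, 'u) index. fst (snd t)"
  have exists: "derivable \<Omega> (\<Union>t\<in>?T. ?pre t) C (\<Union>t\<in>?T. dagger (denote I C) ` ?pre t)"
  proof (rule derivable.Exists)
    fix t assume "t \<in> ?T"
    then obtain m where "m \<in> \<phi>" "t = (0, {m}, {})" by auto
    then show "derivable \<Omega> (?pre t) C (dagger (denote I C) ` ?pre t)"
      using derivable_dagger[OF unit(2,1), of m] pre by auto
  qed
  have strengthen: "\<phi> \<subseteq> (\<Union>t\<in>?T. ?pre t)" by auto
  have weaken: "(\<Union>t\<in>?T. dagger (denote I C) ` ?pre t) \<subseteq> \<psi>"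
    using valid by (auto simp: valid_def)
  show ?thesis by (rule derivable.Consequence[OF strengthen exists weaken post])
qed

end
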